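(* Let $C: f=0$ be a reduced plane curve of degree $d\geq 3$ in $\mathbb{P}^2$ of type $(d,r,m)$ with $m>3$, and suppose $\Delta m:=(2r-d+3)-m=1$. Then, with $\epsilon_1,\ldots,\epsilon_{m-2}$ as in the context, one has $\epsilon_{m-2}=2$, $\epsilon_j=1$ for $1\leq j\leq m-3$, and $$\tau(C)=\frac{d(d-1)}{2}-1+r(d-r-2).$$
   Context: Let $S=\mathbb{C}[x,y,z]$, let $f\in S$ be a reduced homogeneous polynomial of degree $d\geq 3$ defining $C$, and assume $C$ is not a union of $d$ lines through one point. Let $J_f=(f_x,f_y,f_z)$ and $M(f)=S/J_f$. Let $D_0(f)=\{(a,b,c)\in S^3: af_x+bf_y+cf_z=0\}$. The curve is of type $(d,r,m)$ if $D_0(f)$ is minimally generated by $m$ homogeneous elements all of degree $r$. When $m\geq 3$, the minimal graded free resolution of $M(f)$ has the form $$0\to \bigoplus_{i=1}^{m-2}S(-e_i)\to \bigoplus_{j=1}^m S(1-d-r)\to S^3(1-d)\to S,$$ with $e_1\leq\cdots\leq e_{m-2}$, and one writes $e_j=d+r-1+\epsilon_j$ with integers $\epsilon_j\geq 1$. The total Tjurina number $\tau(C)$ is the degree of $J_f$, i.e. the sum of the Tjurina numbers of the singular points of $C$. *)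

theory Defs
  imports Complex_Main "HOL-Library.Poly_Mapping" "HOL-Library.Product_Plus"
begin

text \<open>A monomial x^a y^b z^c is the exponent triple (a,b,c); a polynomial is a
finitely supported map from monomials to complex coefficients (convolution product).\<close>

type_synonym mono3 = "nat \<times> nat \<times> nat"
type_synonym poly3 = "mono3 \<Rightarrow>\<^sub>0 complex"

definition mdeg :: "mono3 \<Rightarrow> nat" where
  "mdeg m = fst m + fst (snd m) + snd (snd m)"

definition const3 :: "complex \<Rightarrow> poly3" where
  "const3 c = Poly_Mapping.single (0,0,0) c"

definition varX :: poly3 where "varX = Poly_Mapping.single (1,0,0) 1"
definition varY :: poly3 where "varY = Poly_Mapping.single (0,1,0) 1"
definition varZ :: poly3 where "varZ = Poly_Mapping.single (0,0,1) 1"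

definition scale3 :: "complex \<Rightarrow> poly3 \<Rightarrow> poly3" where
  "scale3 c p = Poly_Mapping.map (\<lambda>a. c * a) p"

text \<open>homogeneous of degree k (the zero polynomial is homogeneous of every degree)\<close>
definition homog :: "nat \<Rightarrow> poly3 \<Rightarrow> bool" where
  "homog k p \<longleftrightarrow> (\<forall>m \<in> Poly_Mapping.keys p. mdeg m = k)"

definition pdx :: "poly3 \<Rightarrow> poly3" where
  "pdx p = Abs_poly_mapping (\<lambda>(a,b,c). of_nat (Suc a) * Poly_Mapping.lookup p (Suc a, b, c))"
definition pdy :: "poly3 \<Rightarrow> poly3" where
  "pdy p = Abs_poly_mapping (\<lambda>(a,b,c). of_nat (Suc b) * Poly_Mapping.lookup p (a, Suc b, c))"
definition pdz :: "poly3 \<Rightarrow> poly3" where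
  "pdz p = Abs_poly_mapping (\<lambda>(a,b,c). of_nat (Suc c) * Poly_Mapping.lookup p (a, b, Suc c))"

text \<open>Elements of S^n are lists of length n.\<close>

definition lincomb :: "nat \<Rightarrow> poly3 list \<Rightarrow> poly3 list list \<Rightarrow> poly3 list" where
  "lincomb n hs gs = map (\<lambda>i. \<Sum>j<length gs. hs ! j * (gs ! j) ! i) [0..<n]"

definition submod :: "nat \<Rightarrow> poly3 list list \<Rightarrow> poly3 list set" where
  "submod n gs = {lincomb n hs gs | hs. length hs = length gs}"

definition hvec :: "nat \<Rightarrow> poly3 list \<Rightarrow> bool" where
  "hvec k v \<longleftrightarrow> (\<forall>p \<in> set v. homog k p)"

definition irredundant :: "nat \<Rightarrow> poly3 list list \<Rightarrow> bool" where
  "irredundant n gs \<longleftrightarrow>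
     (\<forall>i < length gs. gs ! i \<notin> submod n (take i gs @ drop (Suc i) gs))"

definition reduced3 :: "poly3 \<Rightarrow> bool" where
  "reduced3 f \<longleftrightarrow> f \<noteq> 0 \<and> (\<forall>g. g * g dvd f \<longrightarrow> g dvd 1)"

definition linform :: "complex \<Rightarrow> complex \<Rightarrow> complex \<Rightarrow> poly3" where
  "linform a b c = const3 a * varX + const3 b * varY + const3 c * varZ"

definition concurrent_lines :: "nat \<Rightarrow> poly3 \<Rightarrow> bool" where
  "concurrent_lines d f \<longleftrightarrow>
     (\<exists>p1 p2 p3 :: complex. (p1, p2, p3) \<noteq> (0,0,0) \<and>
        (\<exists>ls :: (complex \<times> complex \<times> complex) list. length ls = d \<and>
           (\<forall>(a,b,c) \<in> set ls. (a,b,c) \<noteq> (0,0,0) \<and> a*p1 + b*p2 + c*p3 = 0) \<and>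
           f = prod_list (map (\<lambda>(a,b,c). linform a b c) ls)))"

definition D0 :: "poly3 \<Rightarrow> poly3 list set" where
  "D0 f = {v. length v = 3 \<and> v!0 * pdx f + v!1 * pdy f + v!2 * pdz f = 0}"

definition syz :: "poly3 list list \<Rightarrow> poly3 list set" where
  "syz \<rho>s = {h. length h = length \<rho>s \<and> lincomb 3 h \<rho>s = replicate 3 0}"

definition minimal_gens_D0 :: "poly3 \<Rightarrow> nat \<Rightarrow> poly3 list list \<Rightarrow> bool" where
  "minimal_gens_D0 f r \<rho>s \<longleftrightarrow>
     (\<forall>\<rho> \<in> set \<rho>s. length \<rho> = 3 \<and> hvec r \<rho>) \<and> submod 3 \<rho>s = D0 f \<and>
     (\<forall>gs. (\<forall>g \<in> set gs. length g = 3) \<and> submod 3 gs = D0 f \<longrightarrow> length \<rho>s \<le> length gs)"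

definition curve_type :: "poly3 \<Rightarrow> nat \<Rightarrow> nat \<Rightarrow> nat \<Rightarrow> bool" where
  "curve_type f d r m \<longleftrightarrow> homog d f \<and> (\<exists>\<rho>s. length \<rho>s = m \<and> minimal_gens_D0 f r \<rho>s)"

definition jac_ideal :: "poly3 \<Rightarrow> poly3 set" where
  "jac_ideal f = {a * pdx f + b * pdy f + c * pdz f | a b c. True}"

text \<open>Hilbert function of M(f) = S/J_f: dim S_k - dim (J_f)_k\<close>
definition hilb_M :: "poly3 \<Rightarrow> nat \<Rightarrow> nat" where
  "hilb_M f k = vector_space.dim scale3 {p. homog k p}
              - vector_space.dim scale3 {p \<in> jac_ideal f. homog k p}"

text \<open>total Tjurina number = degree of J_f = eventual (constant) value of the Hilbert function\<close>
definition tjurina :: "poly3 \<Rightarrow> nat" where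
  "tjurina f = (THE t. \<forall>\<^sub>F k in sequentially. hilb_M f k = t)"

end

theory Submission
  imports Defs "HOL-Computational_Algebra.Polynomial_Factorial"
    "HOL-Computational_Algebra.Field_as_Ring" "HOL-Library.Function_Algebras"
begin

text \<open>
  The syzygy module of \<open>\<rho>s\<close> is a third syzygy module over a polynomial ring in three
  variables, so minimal homogeneous generators of it form a basis: reducing a relation between
  them modulo \<open>x\<close>, then \<open>y\<close>, then \<open>z\<close> ends with a relation having a unit coefficient, which
  irredundance excludes. The resolution of \<open>M(f)\<close> is therefore exact and twice its Hilbert
  function agrees for large degrees with an explicit quadratic polynomial.

  As \<open>f\<close> is squarefree, it is coprime to \<open>f\<^sub>x + t f\<^sub>y + t\<^sup>2 f\<^sub>z\<close> for some \<open>t\<close>. By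
  Euler's formula both lie in the Jacobian ideal, so the Hilbert function of \<open>M(f)\<close> is bounded by
  \<open>d (d - 1)\<close>. The coefficients of the quadratic polynomial in positive degrees thus vanish, which
  says that there are \<open>m - 2\<close> generators and that their degrees add up to \<open>2 r - d + 1 = m - 1\<close>.
  Each degree is at least 1 by minimality of \<open>\<rho>s\<close>, so exactly one of them is 2. The constant
  coefficient is then twice the Tjurina number.
\<close>

section \<open>Polynomials in three variables\<close>

declare split_paired_All [simp del] split_paired_Ex [simp del]

abbreviation lk :: "poly3 \<Rightarrow> mono3 \<Rightarrow> complex" where "lk \<equiv> Poly_Mapping.lookup"
abbreviation sg :: "mono3 \<Rightarrow> complex \<Rightarrow> poly3" where "sg \<equiv> Poly_Mapping.single"
abbreviation ks :: "poly3 \<Rightarrow> mono3 set" where "ks \<equiv> Poly_Mapping.keys"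

lemma poly3_eq_sum_singles: "p = (\<Sum>m\<in>ks p. sg m (lk p m))"
proof (rule poly_mapping_eqI)
  fix k
  show "lk p k = lk (\<Sum>m\<in>ks p. sg m (lk p m)) k"
    by (simp add: lookup_sum lookup_single when_def in_keys_iff)
qed

lemma poly3_induct [case_names single add]:
  assumes s: "\<And>m c. P (sg m c)" and a: "\<And>p q. P p \<Longrightarrow> P q \<Longrightarrow> P (p + q)"
  shows "P p"
proof -
  have "P (\<Sum>m\<in>A. sg m (lk p m))" if "finite A" for A
    using that
  proof (induction A)
    case empty
    then show ?case using s[of 0 0] by simp
  next
    case (insert x F)
    then show ?case using a s by simp
  qed
  from this[OF finite_keys] show ?thesis using poly3_eq_sum_singles by metis
qed

section \<open>Transfer to nested univariate polynomials\<close>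

text \<open>Gives access to gcds and prime factorisation, which
  \<open>complex poly poly poly\<close> carries as a factorial ring. The outermost variable is x,
  the innermost z.\<close>

definition to_poly :: "poly3 \<Rightarrow> complex poly poly poly" where
  "to_poly p = (\<Sum>(a,b,c)\<in>ks p. monom (monom (monom (lk p (a,b,c)) c) b) a)"

lemma to_poly_superset:
  assumes "finite A" "ks p \<subseteq> A"
  shows "to_poly p = (\<Sum>(a,b,c)\<in>A. monom (monom (monom (lk p (a,b,c)) c) b) a)"
  unfolding to_poly_def
  by (rule sum.mono_neutral_left) (use assms in \<open>auto simp: in_keys_iff\<close>)

lemma to_poly_single: "to_poly (sg (a,b,c) u) = monom (monom (monom u c) b) a"
  by (subst to_poly_superset[of "{(a,b,c)}"]) auto

lemma to_poly_add: "to_poly (p + q) = to_poly p + to_poly q"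
proof -
  let ?A = "ks p \<union> ks q"
  have "ks (p + q) \<subseteq> ?A" by (rule keys_add)
  then show ?thesis
    by (simp add: to_poly_superset[of ?A] lookup_add case_prod_beta add_monom[symmetric] sum.distrib)
qed

lemma to_poly_mult: "to_poly (p * q) = to_poly p * to_poly q"
proof (induction p rule: poly3_induct)
  case (single m c)
  show ?case
  proof (induction q rule: poly3_induct)
    case (single m' c')
    then show ?case
      by (cases m; cases m') (simp add: mult_single to_poly_single mult_monom)
  next
    case (add p q)
    then show ?case by (simp add: distrib_left to_poly_add)
  qed
next
  case (add p q)
  then show ?case by (simp add: distrib_right to_poly_add)
qed

lemma coeff_to_poly: "coeff (coeff (coeff (to_poly p) a) b) c = lk p (a,b,c)"
proof (induction p rule: poly3_induct)
  case (single m u)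
  show ?case by (cases m) (auto simp: to_poly_single lookup_single when_def)
next
  case (add p q)
  then show ?case by (simp add: to_poly_add lookup_add)
qed

lemma to_poly_inj: "to_poly p = to_poly q \<longleftrightarrow> p = q"
  by (metis coeff_to_poly poly_mapping_eqI prod_cases3)

lemma to_poly_0 [simp]: "to_poly 0 = 0"
  using to_poly_add[of 0 0] by simp

lemma to_poly_1 [simp]: "to_poly 1 = 1"
  using to_poly_single[of 0 0 0 1]
  by (simp add: zero_prod_def[symmetric] monom_0 flip: single_one one_pCons)

lemma to_poly_eq_0_iff [simp]: "to_poly p = 0 \<longleftrightarrow> p = 0"
  using to_poly_inj[of p 0] by simp

text \<open>The range is closed under sums, so it suffices to reach monomials; \<open>m1\<close>,
  \<open>m2\<close> and \<open>m3\<close> expand the coefficients one nesting level at a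
  time.\<close>

lemma to_poly_surj: "\<exists>p. to_poly p = q"
proof -
  let ?R = "range to_poly"
  have add: "P + Q \<in> ?R" if "P \<in> ?R" "Q \<in> ?R" for P Q
    using that by (metis (no_types, opaque_lifting) image_iff rangeI to_poly_add)
  have sm: "sum g A \<in> ?R" if "\<And>i. i \<in> A \<Longrightarrow> g i \<in> ?R" for g and A :: "nat set"
    using that
  proof (induction A rule: infinite_finite_induct)
    case (infinite A)
    then show ?case by (metis rangeI sum.infinite to_poly_0)
  next
    case empty
    then show ?case by (metis rangeI sum.empty to_poly_0)
  next
    case (insert x F)
    then show ?case by (simp add: add)
  qed
  have m1: "monom (monom (monom u c) b) a \<in> ?R" for u c b a
    by (metis rangeI to_poly_single)
  have m2: "monom (monom r b) a \<in> ?R" for r :: "complex poly" and b a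
  proof -
    have "monom (monom (\<Sum>c\<in>A. monom (coeff r c) c) b) a
        = (\<Sum>c\<in>A. monom (monom (monom (coeff r c) c) b) a)" if "finite A" for A
      using that by (induction A) (simp_all add: add_monom[symmetric])
    from this[of "{..degree r}"] show ?thesis
      using poly_as_sum_of_monoms[of r] sm[OF m1] by simp
  qed
  have m3: "monom r a \<in> ?R" for r :: "complex poly poly" and a
  proof -
    have "monom (\<Sum>c\<in>A. monom (coeff r c) c) a
        = (\<Sum>c\<in>A. monom (monom (coeff r c) c) a)" if "finite A" for A
      using that by (induction A) (simp_all add: add_monom[symmetric])
    from this[of "{..degree r}"] show ?thesis
      using poly_as_sum_of_monoms[of r] sm[OF m2] by simp
  qed
  have "q \<in> ?R" using poly_as_sum_of_monoms[of q] sm[OF m3] by metis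
  then show ?thesis by auto
qed

text \<open>Surjectivity matters from left to right: a quotient found among the nested polynomials
  has to come from a \<open>poly3\<close>.\<close>

lemma to_poly_dvd_iff: "to_poly p dvd to_poly q \<longleftrightarrow> p dvd q"
  unfolding dvd_def by (metis to_poly_inj to_poly_mult to_poly_surj)

lemma poly3_mult_eq_0: "p * q = 0 \<longleftrightarrow> p = 0 \<or> q = (0::poly3)"
  by (metis mult_eq_0_iff to_poly_eq_0_iff to_poly_mult)

section \<open>Homogeneous components and degree\<close>

definition restr :: "(mono3 \<Rightarrow> bool) \<Rightarrow> poly3 \<Rightarrow> poly3" where
  "restr P p = Poly_Mapping.mapp (\<lambda>m c. if P m then c else 0) p"

lemma lookup_restr: "lk (restr P p) m = (if P m then lk p m else 0)"
  by (auto simp: restr_def lookup_mapp when_def in_keys_iff)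

definition hcomp :: "nat \<Rightarrow> poly3 \<Rightarrow> poly3" where
  "hcomp k p = restr (\<lambda>m. mdeg m = k) p"

lemma lookup_hcomp: "lk (hcomp k p) m = (if mdeg m = k then lk p m else 0)"
  by (simp add: hcomp_def lookup_restr)

lemma homog_iff: "homog k p \<longleftrightarrow> (\<forall>m. mdeg m \<noteq> k \<longrightarrow> lk p m = 0)"
  unfolding homog_def by (auto simp: in_keys_iff)

lemma homog_hcomp [simp]: "homog k (hcomp k p)"
  by (auto simp: homog_iff lookup_hcomp)

lemma hcomp_homog: "homog k p \<Longrightarrow> hcomp j p = (if j = k then p else 0)"
  by (rule poly_mapping_eqI) (auto simp: homog_iff lookup_hcomp)

lemma hcomp_add: "hcomp k (p + q) = hcomp k p + hcomp k q"
  by (rule poly_mapping_eqI) (auto simp: lookup_hcomp lookup_add)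

lemma hcomp_0 [simp]: "hcomp k 0 = 0"
  by (rule poly_mapping_eqI) (auto simp: lookup_hcomp)

lemma hcomp_sum: "hcomp k (\<Sum>i\<in>A. g i) = (\<Sum>i\<in>A. hcomp k (g i))"
  by (induction A rule: infinite_finite_induct) (simp_all add: hcomp_add)

lemma homog_0 [simp]: "homog k 0" by (simp add: homog_def)

lemma homog_add: "homog k p \<Longrightarrow> homog k q \<Longrightarrow> homog k (p + q)"
  by (simp add: homog_iff lookup_add)

lemma homog_minus: "homog k p \<Longrightarrow> homog k (- p)"
  by (simp add: homog_iff)

lemma homog_sum: "(\<And>i. i \<in> A \<Longrightarrow> homog k (g i)) \<Longrightarrow> homog k (sum g A)"
  by (induction A rule: infinite_finite_induct) (simp_all add: homog_add)

lemma mdeg_add: "mdeg (m + n) = mdeg m + mdeg n"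
  by (cases m; cases n) (simp add: mdeg_def)

lemma homog_mult: "homog k p \<Longrightarrow> homog j q \<Longrightarrow> homog (k + j) (p * q)"
  unfolding homog_def
proof (intro ballI)
  fix m assume pq: "\<forall>m\<in>ks p. mdeg m = k" "\<forall>m\<in>ks q. mdeg m = j" and "m \<in> ks (p * q)"
  then obtain a b where "m = a + b" "a \<in> ks p" "b \<in> ks q" using keys_mult[of p q] by blast
  then show "mdeg m = k + j" using pq by (simp add: mdeg_add)
qed

lemma homog_single: "homog k (sg m c) \<longleftrightarrow> c = 0 \<or> mdeg m = k"
  by (auto simp: homog_iff lookup_single when_def)

lemma sum_hcomp:
  assumes "\<And>m. m \<in> ks p \<Longrightarrow> mdeg m \<le> N"
  shows "p = (\<Sum>i\<le>N. hcomp i p)"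
proof (rule poly_mapping_eqI)
  fix m
  show "lk p m = lk (\<Sum>i\<le>N. hcomp i p) m"
  proof (cases "m \<in> ks p")
    case True
    then show ?thesis using assms[of m] by (simp add: lookup_sum lookup_hcomp)
  next
    case False
    then show ?thesis by (simp add: lookup_sum lookup_hcomp in_keys_iff)
  qed
qed

lemma ex_mdeg_bound: "\<exists>N. \<forall>m\<in>ks p. mdeg m \<le> N"
  using finite_nat_set_iff_bounded_le[of "mdeg ` ks p"] by auto

text \<open>Multiplication by \<open>q\<close> shifts degrees by exactly \<open>j\<close>, so among
  the homogeneous parts of \<open>p\<close> only the one of degree \<open>k - j\<close> contributes.
  The case distinction guards the truncated subtraction.\<close>

lemma hcomp_mult_homog:
  assumes "homog j q"
  shows "hcomp k (p * q) = (if j \<le> k then hcomp (k - j) p * q else 0)"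
proof -
  obtain N where N: "\<forall>m\<in>ks p. mdeg m \<le> N" using ex_mdeg_bound by blast
  have "hcomp k (p * q) = hcomp k ((\<Sum>i\<le>N. hcomp i p) * q)"
    using sum_hcomp[of p N] N by metis
  also have "\<dots> = (\<Sum>i\<le>N. if k = i + j then hcomp i p * q else 0)"
    by (simp add: sum_distrib_right hcomp_sum hcomp_homog[OF homog_mult[OF homog_hcomp assms]])
  also have "\<dots> = (\<Sum>i\<le>N. if i = k - j then (if j \<le> k then hcomp (k - j) p * q else 0) else 0)"
    by (rule sum.cong) auto
  also have "\<dots> = (if j \<le> k then hcomp (k - j) p * q else 0)"
  proof (cases "k - j \<le> N")
    case True
    then show ?thesis by simp
  next
    case False
    have "hcomp (k - j) p = 0"
      by (rule poly_mapping_eqI) (use False N in \<open>metis in_keys_iff lookup_hcomp lookup_zero\<close>)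
    then show ?thesis using False by simp
  qed
  finally show ?thesis .
qed

text \<open>In a domain the product of the two components of top degree is nonzero, and it is the
  component of \<open>p * q\<close> in degree \<open>P + Q\<close>. So a nonzero multiple of
  \<open>p\<close> cannot have smaller degree than \<open>p\<close>.\<close>

lemma top_degree_mult:
  assumes "p \<noteq> 0" "q \<noteq> 0"
  obtains m where "m \<in> ks (p * q)" "\<And>k. k \<in> ks p \<Longrightarrow> mdeg k \<le> mdeg m"
proof -
  define P where "P = Max (mdeg ` ks p)"
  define Q where "Q = Max (mdeg ` ks q)"
  have ne: "ks p \<noteq> {}" "ks q \<noteq> {}" using assms by (simp_all add: keys_eq_empty)
  have P: "mdeg m \<le> P" if "m \<in> ks p" for m using that unfolding P_def by simp
  have Q: "mdeg m \<le> Q" if "m \<in> ks q" for m using that unfolding Q_def by simp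
  have "P \<in> mdeg ` ks p" "Q \<in> mdeg ` ks q" unfolding P_def Q_def using ne by (simp_all add: Max_in)
  then obtain mp mq where mp: "mp \<in> ks p" "mdeg mp = P" and mq: "mq \<in> ks q" "mdeg mq = Q" by blast
  have p0: "hcomp P p \<noteq> 0" using mp by (metis in_keys_iff lookup_hcomp lookup_zero)
  have q0: "hcomp Q q \<noteq> 0" using mq by (metis in_keys_iff lookup_hcomp lookup_zero)
  have big: "hcomp k q = 0" if "k > Q" for k
    by (rule poly_mapping_eqI) (use that Q in \<open>force simp: lookup_hcomp in_keys_iff\<close>)
  have "hcomp (P + Q) (p * q) = hcomp (P + Q) ((\<Sum>i\<le>P. hcomp i p) * q)"
    using sum_hcomp[of p P] P by metis
  also have "\<dots> = (\<Sum>i\<le>P. hcomp (P + Q) (q * hcomp i p))"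
    by (simp add: sum_distrib_right sum_distrib_left hcomp_sum mult.commute[of _ q])
  also have "\<dots> = (\<Sum>i\<le>P. if i = P then hcomp Q q * hcomp P p else 0)"
  proof (rule sum.cong)
    fix i assume "i \<in> {..P}"
    then show "hcomp (P + Q) (q * hcomp i p) = (if i = P then hcomp Q q * hcomp P p else 0)"
      by (subst hcomp_mult_homog[OF homog_hcomp]) (auto simp: big)
  qed simp
  also have "\<dots> = hcomp Q q * hcomp P p" by simp
  also have "\<dots> \<noteq> 0" using p0 q0 by (simp add: poly3_mult_eq_0)
  finally have "hcomp (P + Q) (p * q) \<noteq> 0" .
  then obtain m where "lk (hcomp (P + Q) (p * q)) m \<noteq> 0" by (metis lookup_zero poly_mapping_eqI)
  then have m: "m \<in> ks (p * q)" "mdeg m = P + Q" by (auto simp: lookup_hcomp in_keys_iff split: if_splits)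
  show ?thesis
    by (rule that[OF m(1)]) (use P m(2) in fastforce)
qed

section \<open>Multiplication and division by monomials\<close>

lemma lookup_single_mult: "lk (sg m c * q) (m + k) = c * lk q k"
proof (induction q rule: poly3_induct)
  case (single n u)
  show ?case by (simp add: mult_single lookup_single when_def)
next
  case (add p q)
  then show ?case by (simp add: distrib_left lookup_add)
qed

lemma lookup_single_mult_0: "(\<And>k. n \<noteq> m + k) \<Longrightarrow> lk (sg m c * q) n = 0"
proof (induction q rule: poly3_induct)
  case (single n' u)
  then show ?case by (simp add: mult_single lookup_single when_def) metis
next
  case (add p q)
  then show ?case by (simp add: distrib_left lookup_add)
qed

text \<open>The quotient is \<open>p\<close> with all exponents shifted down by \<open>m\<close>;
  translation by \<open>m\<close> is injective, so \<open>map_key\<close> applies.\<close>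

lemma single_mult_factor:
  assumes "\<And>n. lk p n \<noteq> 0 \<Longrightarrow> \<exists>k. n = m + k"
  obtains w where "p = sg m 1 * w" "\<And>k. lk w k = lk p (m + k)"
proof
  have inj: "inj ((+) m)" by simp
  let ?w = "Poly_Mapping.map_key ((+) m) p"
  show lw: "lk ?w k = lk p (m + k)" for k by (simp add: map_key.rep_eq[OF inj])
  show "p = sg m 1 * ?w"
  proof (rule poly_mapping_eqI)
    fix n
    show "lk p n = lk (sg m 1 * ?w) n"
    proof (cases "\<exists>k. n = m + k")
      case True
      then show ?thesis by (auto simp: lookup_single_mult lw)
    next
      case False
      then show ?thesis using assms[of n] lookup_single_mult_0[of n m 1 ?w] by auto
    qed
  qed
qed

section \<open>Partial derivatives and Euler's formula\<close>

lemma lookup_pdx: "lk (pdx p) (a,b,c) = of_nat (Suc a) * lk p (Suc a,b,c)"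
proof -
  \<comment> \<open>\<open>Abs_poly_mapping\<close> can be unfolded only for finite support, which
    is inherited from \<open>p\<close> because raising an exponent is injective.\<close>
  have "finite ((\<lambda>(a,b,c). (Suc a,b,c)) -` ks p)"
    by (rule finite_vimageI) (auto simp: inj_on_def)
  moreover have "{x. (case x of (a,b,c) \<Rightarrow> of_nat (Suc a) * lk p (Suc a,b,c)) \<noteq> 0} \<subseteq> (\<lambda>(a,b,c). (Suc a,b,c)) -` ks p"
    by (auto simp: in_keys_iff)
  ultimately have fin: "finite {x. (case x of (a,b,c) \<Rightarrow> of_nat (Suc a) * lk p (Suc a,b,c)) \<noteq> 0}"
    by (rule finite_subset[rotated])
  show ?thesis unfolding pdx_def by (subst lookup_Abs_poly_mapping[OF fin]) simp
qed

lemma lookup_pdy: "lk (pdy p) (a,b,c) = of_nat (Suc b) * lk p (a,Suc b,c)"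
proof -
  have "finite ((\<lambda>(a,b,c). (a,Suc b,c)) -` ks p)"
    by (rule finite_vimageI) (auto simp: inj_on_def)
  moreover have "{x. (case x of (a,b,c) \<Rightarrow> of_nat (Suc b) * lk p (a,Suc b,c)) \<noteq> 0} \<subseteq> (\<lambda>(a,b,c). (a,Suc b,c)) -` ks p"
    by (auto simp: in_keys_iff)
  ultimately have fin: "finite {x. (case x of (a,b,c) \<Rightarrow> of_nat (Suc b) * lk p (a,Suc b,c)) \<noteq> 0}"
    by (rule finite_subset[rotated])
  show ?thesis unfolding pdy_def by (subst lookup_Abs_poly_mapping[OF fin]) simp
qed

lemma lookup_pdz: "lk (pdz p) (a,b,c) = of_nat (Suc c) * lk p (a,b,Suc c)"
proof -
  have "finite ((\<lambda>(a,b,c). (a,b,Suc c)) -` ks p)"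
    by (rule finite_vimageI) (auto simp: inj_on_def)
  moreover have "{x. (case x of (a,b,c) \<Rightarrow> of_nat (Suc c) * lk p (a,b,Suc c)) \<noteq> 0} \<subseteq> (\<lambda>(a,b,c). (a,b,Suc c)) -` ks p"
    by (auto simp: in_keys_iff)
  ultimately have fin: "finite {x. (case x of (a,b,c) \<Rightarrow> of_nat (Suc c) * lk p (a,b,Suc c)) \<noteq> 0}"
    by (rule finite_subset[rotated])
  show ?thesis unfolding pdz_def by (subst lookup_Abs_poly_mapping[OF fin]) simp
qed

lemmas lookup_pd = lookup_pdx lookup_pdy lookup_pdz

lemma pd_add: "pdx (p + q) = pdx p + pdx q" "pdy (p + q) = pdy p + pdy q" "pdz (p + q) = pdz p + pdz q"
  by (rule poly_mapping_eqI, auto simp: lookup_pd lookup_add algebra_simps)+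

text \<open>At exponent 0 the truncated \<open>a - 1\<close> does no harm, since the coefficient
  carries the factor \<open>of_nat a\<close>.\<close>

lemma pd_single:
  "pdx (sg (a,b,c) u) = sg (a - 1,b,c) (of_nat a * u)"
  "pdy (sg (a,b,c) u) = sg (a,b - 1,c) (of_nat b * u)"
  "pdz (sg (a,b,c) u) = sg (a,b,c - 1) (of_nat c * u)"
  by (rule poly_mapping_eqI, auto simp: lookup_pd lookup_single when_def split: if_splits)+

lemma pd_mult_single:
  "pdx (sg (a,b,c) u * sg (a',b',c') v) = pdx (sg (a,b,c) u) * sg (a',b',c') v + sg (a,b,c) u * pdx (sg (a',b',c') v)"
  "pdy (sg (a,b,c) u * sg (a',b',c') v) = pdy (sg (a,b,c) u) * sg (a',b',c') v + sg (a,b,c) u * pdy (sg (a',b',c') v)"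
  "pdz (sg (a,b,c) u * sg (a',b',c') v) = pdz (sg (a,b,c) u) * sg (a',b',c') v + sg (a,b,c) u * pdz (sg (a',b',c') v)"
  subgoal by (cases a; cases a') (simp_all add: pd_single mult_single algebra_simps flip: single_add)
  subgoal by (cases b; cases b') (simp_all add: pd_single mult_single single_add[symmetric] algebra_simps)
  subgoal by (cases c; cases c') (simp_all add: pd_single mult_single single_add[symmetric] algebra_simps)
  done

lemma pd_mult:
  "pdx (p * q) = pdx p * q + p * pdx q \<and> pdy (p * q) = pdy p * q + p * pdy q \<and> pdz (p * q) = pdz p * q + p * pdz q"
proof (induction p rule: poly3_induct)
  case (single m c)
  show ?case
  proof (induction q rule: poly3_induct)
    case (single m' c')
    then show ?case by (cases m; cases m') (simp add: pd_mult_single)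
  next
    case (add p q)
    then show ?case by (simp add: distrib_left pd_add algebra_simps)
  qed
next
  case (add p q)
  then show ?case by (simp add: distrib_right pd_add algebra_simps)
qed

lemma mdeg_Suc [simp]: "mdeg (Suc a,b,c) = Suc (mdeg (a,b,c))" "mdeg (a,Suc b,c) = Suc (mdeg (a,b,c))"
  "mdeg (a,b,Suc c) = Suc (mdeg (a,b,c))"
  by (simp_all add: mdeg_def)

lemma homog_pd:
  assumes "homog d p"
  shows "homog (d - 1) (pdx p)" "homog (d - 1) (pdy p)" "homog (d - 1) (pdz p)"
  using assms by (auto simp: homog_iff lookup_pd)

text \<open>The coefficientwise form makes sense without homogeneity and is additive in
  \<open>p\<close>, so it can be checked on monomials.\<close>

lemma euler_lookup:
  "lk (varX * pdx p + varY * pdy p + varZ * pdz p) m = of_nat (mdeg m) * lk p m"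
proof (induction p rule: poly3_induct)
  case (single n u)
  obtain a b c where n: "n = (a,b,c)" by (cases n) auto
  have "varX * pdx (sg n u) = sg n (of_nat a * u)"
    by (cases a) (simp_all add: n varX_def pd_single mult_single)
  moreover have "varY * pdy (sg n u) = sg n (of_nat b * u)"
    by (cases b) (simp_all add: n varY_def pd_single mult_single)
  moreover have "varZ * pdz (sg n u) = sg n (of_nat c * u)"
    by (cases c) (simp_all add: n varZ_def pd_single mult_single)
  ultimately show ?case
    by (auto simp: lookup_add lookup_single when_def n mdeg_def algebra_simps)
next
  case (add p q)
  have "varX * pdx (p + q) + varY * pdy (p + q) + varZ * pdz (p + q)
      = (varX * pdx p + varY * pdy p + varZ * pdz p) + (varX * pdx q + varY * pdy q + varZ * pdz q)"
    by (simp add: pd_add algebra_simps)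
  with add show ?case by (simp add: lookup_add[of "_ + _ + _" "_ + _ + _"] lookup_add[of p q] distrib_left)
qed

lemma euler:
  assumes "homog d p"
  shows "varX * pdx p + varY * pdy p + varZ * pdz p = const3 (of_nat d) * p"
proof (rule poly_mapping_eqI)
  fix m
  have "lk (const3 (of_nat d) * p) (0 + m) = of_nat d * lk p m"
    unfolding const3_def by (metis lookup_single_mult zero_prod_def)
  then show "lk (varX * pdx p + varY * pdy p + varZ * pdz p) m = lk (const3 (of_nat d) * p) m"
    using assms by (cases "mdeg m = d") (simp_all add: euler_lookup homog_iff)
qed

lemma lookup_const3_mult: "lk (const3 c * p) m = c * lk p m"
  unfolding const3_def by (metis add_0 lookup_single_mult zero_prod_def)

lemma const3_mult: "const3 a * const3 b = const3 (a * b)"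
  by (simp add: const3_def mult_single)

lemma const3_1 [simp]: "const3 1 = 1"
  by (simp add: const3_def zero_prod_def[symmetric])

lemma scale3_eq: "scale3 c p = const3 c * p"
  unfolding scale3_def const3_def by (metis mult_map_scale_conv_mult zero_prod_def)

section \<open>Squarefree polynomials and generic derivatives\<close>

text \<open>Differentiation lowers the degree, while a nonzero multiple of \<open>p\<close> has at
  least the degree of \<open>p\<close>.\<close>

lemma pd_dvd_imp_0:
  "p dvd pdx p \<Longrightarrow> pdx p = 0" "p dvd pdy p \<Longrightarrow> pdy p = 0" "p dvd pdz p \<Longrightarrow> pdz p = 0"
proof -
  have *: "r = 0" if "p dvd r" and r: "\<And>m. m \<in> ks r \<Longrightarrow> \<exists>k\<in>ks p. mdeg k > mdeg m" for r
  proof (rule ccontr)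
    assume "r \<noteq> 0"
    obtain w where w: "r = p * w" using \<open>p dvd r\<close> by blast
    then have "p \<noteq> 0" "w \<noteq> 0" using \<open>r \<noteq> 0\<close> by auto
    then obtain m where "m \<in> ks r" "\<And>k. k \<in> ks p \<Longrightarrow> mdeg k \<le> mdeg m"
      using top_degree_mult w by metis
    then show False using r by (meson not_less)
  qed
  show "pdx p = 0" if "p dvd pdx p"
  proof (rule *[OF that])
    fix m assume m: "m \<in> ks (pdx p)"
    obtain a b c where abc: "m = (a,b,c)" by (cases m)
    have "(Suc a,b,c) \<in> ks p" using m by (auto simp: abc in_keys_iff lookup_pd)
    then show "\<exists>k\<in>ks p. mdeg k > mdeg m" by (rule bexI[rotated]) (simp add: abc)
  qed
  show "pdy p = 0" if "p dvd pdy p"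
  proof (rule *[OF that])
    fix m assume m: "m \<in> ks (pdy p)"
    obtain a b c where abc: "m = (a,b,c)" by (cases m)
    have "(a,Suc b,c) \<in> ks p" using m by (auto simp: abc in_keys_iff lookup_pd)
    then show "\<exists>k\<in>ks p. mdeg k > mdeg m" by (rule bexI[rotated]) (simp add: abc)
  qed
  show "pdz p = 0" if "p dvd pdz p"
  proof (rule *[OF that])
    fix m assume m: "m \<in> ks (pdz p)"
    obtain a b c where abc: "m = (a,b,c)" by (cases m)
    have "(a,b,Suc c) \<in> ks p" using m by (auto simp: abc in_keys_iff lookup_pd)
    then show "\<exists>k\<in>ks p. mdeg k > mdeg m" by (rule bexI[rotated]) (simp add: abc)
  qed
qed

lemma pd_all_0_const:
  assumes "pdx p = 0" "pdy p = 0" "pdz p = 0"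
  shows "p = const3 (lk p (0,0,0))"
proof (rule poly_mapping_eqI)
  fix m :: mono3
  obtain a b c where abc: "m = (a,b,c)" by (cases m)
  have X: "lk p (Suc a,b,c) = 0" for a b c using lookup_pdx[of p a b c] assms by (simp del: of_nat_Suc)
  have Y: "lk p (a,Suc b,c) = 0" for a b c using lookup_pdy[of p a b c] assms by (simp del: of_nat_Suc)
  have Z: "lk p (a,b,Suc c) = 0" for a b c using lookup_pdz[of p a b c] assms by (simp del: of_nat_Suc)
  show "lk p m = lk (const3 (lk p (0,0,0))) m"
    unfolding abc const3_def by (cases a; cases b; cases c) (simp_all add: X Y Z lookup_single)
qed

text \<open>With \<open>f = p * q\<close>, squarefreeness keeps \<open>p\<close> from dividing
  \<open>q\<close>. If \<open>p\<close> divides \<open>pdx f = pdx p * q + p * pdx q\<close>, it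
  therefore divides \<open>pdx p\<close>, which is then 0 by degree; likewise for y and z. So
  \<open>p\<close> would be a nonzero constant, which is not prime.\<close>

lemma reduced3_prime_not_dvd_pd:
  assumes red: "reduced3 f" and P: "prime_elem P" "P dvd to_poly f"
  shows "\<not> (P dvd to_poly (pdx f) \<and> P dvd to_poly (pdy f) \<and> P dvd to_poly (pdz f))"
proof
  assume all: "P dvd to_poly (pdx f) \<and> P dvd to_poly (pdy f) \<and> P dvd to_poly (pdz f)"
  obtain p where p: "to_poly p = P" using to_poly_surj by blast
  then obtain q where f: "f = p * q" using P(2) to_poly_dvd_iff by blast
  have nu: "\<not> p dvd 1" using P(1) p to_poly_dvd_iff[of p 1] by auto
  have nq: "\<not> p dvd q" using red nu unfolding reduced3_def f by (metis mult_dvd_mono dvd_refl)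
  have div: "p dvd r" if "p dvd r * q + p * s" for r s
  proof -
    have "p dvd r * q" using that by (metis dvd_add_triv_right_iff dvd_triv_left dvd_add_left_iff)
    then have "P dvd to_poly r * to_poly q" using p by (metis to_poly_dvd_iff to_poly_mult)
    then show ?thesis using P(1) nq p by (metis prime_elem_dvd_mult_iff to_poly_dvd_iff)
  qed
  have "p dvd pdx f" "p dvd pdy f" "p dvd pdz f" using all p to_poly_dvd_iff by blast+
  then have "p dvd pdx p" "p dvd pdy p" "p dvd pdz p"
    unfolding f using pd_mult[of p q] div by metis+
  then have "pdx p = 0" "pdy p = 0" "pdz p = 0" using pd_dvd_imp_0 by blast+
  then have c: "p = const3 (lk p (0,0,0))" by (rule pd_all_0_const)
  have "p \<noteq> 0" using P p by auto
  then have "lk p (0,0,0) \<noteq> 0" using c by (auto simp: const3_def)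
  then have "1 = p * const3 (1 / lk p (0,0,0))"
    using const3_mult[of "lk p (0,0,0)" "1 / lk p (0,0,0)"] c by simp
  then show False using nu by (metis dvd_triv_left)
qed

text \<open>The coefficient vectors (1, t, t^2) are chosen so that any three of them are linearly
  independent (Vandermonde).\<close>

definition genpd :: "poly3 \<Rightarrow> nat \<Rightarrow> poly3" where
  "genpd f t = pdx f + const3 (of_nat t) * pdy f + const3 (of_nat t ^ 2) * pdz f"

lemma dvd_const3_mult_cancel:
  assumes "P dvd to_poly (const3 c * p)" "c \<noteq> 0"
  shows "P dvd to_poly p"
proof -
  have "p = const3 (1 / c) * (const3 c * p)"
    using assms(2) by (simp add: const3_mult flip: mult.assoc)
  then show ?thesis using assms(1) by (metis dvd_mult to_poly_mult)
qed

lemma const3_add: "const3 (a + b) = const3 a + const3 b"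
  and const3_diff: "const3 (a - b) = const3 a - const3 b"
  by (simp_all add: const3_def single_add single_diff)

lemma to_poly_diff: "to_poly (p - q) = to_poly p - to_poly q"
  using to_poly_add[of "p - q" q] by simp

text \<open>Divided differences invert the Vandermonde system: the first ones are \<open>?h\<close>,
  the second one isolates \<open>pdz f\<close>, and back substitution gives the other two.\<close>

lemma genpd_dvd_all:
  assumes "P dvd to_poly (genpd f s)" "P dvd to_poly (genpd f t)" "P dvd to_poly (genpd f u)"
    and "s \<noteq> t" "s \<noteq> u" "t \<noteq> u"
  shows "P dvd to_poly (pdx f) \<and> P dvd to_poly (pdy f) \<and> P dvd to_poly (pdz f)"
proof -
  let ?h = "\<lambda>s t. pdy f + const3 (of_nat s + of_nat t) * pdz f"
  have h: "P dvd to_poly (?h s t)"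
    if "P dvd to_poly (genpd f s)" "P dvd to_poly (genpd f t)" "s \<noteq> t" for s t
  proof -
    have sq: "const3 (a ^ 2) = const3 a * const3 a" for a by (simp add: const3_mult power2_eq_square)
    have "genpd f s - genpd f t = const3 (of_nat s - of_nat t) * ?h s t"
      unfolding genpd_def sq const3_add const3_diff by (simp add: algebra_simps)
    moreover have "P dvd to_poly (genpd f s - genpd f t)"
      using that by (simp add: to_poly_diff)
    ultimately have "P dvd to_poly (const3 (of_nat s - of_nat t) * ?h s t)" by metis
    then show ?thesis using that(3) by (rule_tac dvd_const3_mult_cancel[of P "of_nat s - of_nat t"]) auto
  qed
  have "?h s t - ?h s u = const3 (of_nat t - of_nat u) * pdz f"
    unfolding const3_add const3_diff by (simp add: algebra_simps)
  moreover have "P dvd to_poly (?h s t - ?h s u)"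
    unfolding to_poly_diff using assms by (intro dvd_diff h)
  ultimately have "P dvd to_poly (const3 (of_nat t - of_nat u) * pdz f)" by metis
  then have z: "P dvd to_poly (pdz f)"
    using assms(6) by (rule_tac dvd_const3_mult_cancel[of P "of_nat t - of_nat u"]) auto
  have y: "P dvd to_poly (pdy f)"
    using h[OF assms(1,2,4)] z unfolding to_poly_add to_poly_mult
    by (simp add: dvd_add_left_iff)
  have x: "P dvd to_poly (pdx f)"
    using assms(1) y z unfolding genpd_def to_poly_add to_poly_mult
    by (simp add: dvd_add_left_iff)
  show ?thesis using x y z by blast
qed

text \<open>A prime factor of \<open>f\<close> can divide \<open>genpd f t\<close> for at most two
  values of \<open>t\<close>, otherwise it would divide all partial derivatives. If coprimality
  failed for every \<open>t\<close>, one of the finitely many prime factors would occur infinitely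
  often.\<close>

lemma ex_coprime_genpd:
  assumes red: "reduced3 f"
  shows "\<exists>t. coprime (to_poly f) (to_poly (genpd f t))"
proof (rule ccontr)
  assume neg: "\<not> ?thesis"
  let ?F = "to_poly f"
  have F0: "?F \<noteq> 0" using red by (simp add: reduced3_def)
  have "\<exists>P. P \<in> prime_factors ?F \<and> P dvd to_poly (genpd f t)" for t
  proof -
    let ?g = "gcd ?F (to_poly (genpd f t))"
    have "\<not> is_unit ?g" using neg by (simp add: coprime_iff_gcd_eq_1)
    moreover have "?g \<noteq> 0" using F0 by simp
    ultimately obtain P where "prime P" "P dvd ?g" using prime_divisor_exists by blast
    then show ?thesis using F0 by (auto simp: prime_factors_dvd)
  qed
  then obtain P where P: "\<And>t. P t \<in> prime_factors ?F" "\<And>t. P t dvd to_poly (genpd f t)" by metis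
  have "finite (P ` UNIV)" by (rule finite_subset[of _ "prime_factors ?F"]) (use P in auto)
  then obtain t0 where inf: "infinite {t \<in> UNIV. P t = P t0}"
    using pigeonhole_infinite[of "UNIV :: nat set" P] by auto
  obtain T where T: "T \<subseteq> {t \<in> UNIV. P t = P t0}" "card T = 3" "finite T"
    using infinite_arbitrarily_large[OF inf] by metis
  then obtain s t u where "T = {s,t,u}" "s \<noteq> t" "s \<noteq> u" "t \<noteq> u"
    by (auto simp: card_3_iff)
  with T have "P t0 dvd to_poly (genpd f s)" "P t0 dvd to_poly (genpd f t)" "P t0 dvd to_poly (genpd f u)"
    using P(2)[of s] P(2)[of t] P(2)[of u] by auto
  then have "P t0 dvd to_poly (pdx f) \<and> P t0 dvd to_poly (pdy f) \<and> P t0 dvd to_poly (pdz f)"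
    using \<open>s \<noteq> t\<close> \<open>s \<noteq> u\<close> \<open>t \<noteq> u\<close> by (rule genpd_dvd_all)
  moreover have "prime_elem (P t0)" "P t0 dvd ?F" using P(1)[of t0] by (auto dest: in_prime_factors_imp_prime)
  ultimately show False using reduced3_prime_not_dvd_pd[OF red] by blast
qed

text \<open>Coprimality makes \<open>genpd f t\<close> a nonzerodivisor modulo \<open>f\<close>, the
  form in which the dimension count uses it.\<close>

lemma ex_genpd_regular:
  assumes "reduced3 f"
  shows "\<exists>t. \<forall>u. f dvd u * genpd f t \<longrightarrow> f dvd u"
proof -
  obtain t where t: "coprime (to_poly f) (to_poly (genpd f t))" using ex_coprime_genpd[OF assms] by blast
  show ?thesis
  proof (intro exI allI impI)
    fix u assume "f dvd u * genpd f t"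
    then have "to_poly f dvd to_poly u * to_poly (genpd f t)" by (metis to_poly_dvd_iff to_poly_mult)
    then show "f dvd u" using t by (metis coprime_dvd_mult_left_iff to_poly_dvd_iff)
  qed
qed

section \<open>Dimensions of graded pieces\<close>

text \<open>Rank-nullity inside a possibly infinite-dimensional space, hence the finite spanning set
  \<open>B0\<close>. A basis \<open>B\<close> of the kernel is extended to a basis \<open>C\<close>
  of \<open>V\<close>, and \<open>T\<close> maps \<open>C - B\<close> to a basis of the
  image.\<close>

lemma (in vector_space_pair) dim_eq_kernel_plus_image:
  assumes lin: "Vector_Spaces.linear s1 s2 T" and V: "vs1.subspace V" and fin: "finite B0" "V \<subseteq> vs1.span B0"
  shows "vs1.dim V = vs1.dim {v \<in> V. T v = 0} + vs2.dim (T ` V)"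
proof -
  interpret T: Vector_Spaces.linear s1 s2 T by (rule lin)
  let ?K = "{v \<in> V. T v = 0}"
  obtain B where B: "B \<subseteq> ?K" "vs1.independent B" "?K \<subseteq> vs1.span B" "card B = vs1.dim ?K"
    using vs1.basis_exists by blast
  obtain C where C: "B \<subseteq> C" "C \<subseteq> V" "vs1.independent C" "V \<subseteq> vs1.span C"
    using vs1.maximal_independent_subset_extend[of B V] B by blast
  have finC: "finite C" using vs1.independent_span_bound[OF fin(1) C(3)] C(2) fin(2) by blast
  let ?D = "C - B"
  have indD: "vs1.independent ?D" using C(3) vs1.independent_mono by blast
  \<comment> \<open>A kernel vector in the span of \<open>?D\<close> also lies in the span of
    \<open>B\<close>, so its representation over \<open>C\<close> is supported in two disjoint sets
    and vanishes.\<close>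
  have inj: "inj_on T (vs1.span ?D)"
  proof (subst T.inj_on_iff_eq_0[OF vs1.subspace_span], intro ballI impI)
    fix x assume x: "x \<in> vs1.span ?D" "T x = 0"
    have "x \<in> V" using x(1) vs1.span_minimal[OF _ V, of ?D] C(2) by blast
    then have xB: "x \<in> vs1.span B" using x(2) B(3) by blast
    have 1: "vs1.representation C x = vs1.representation ?D x"
      by (rule vs1.representation_extend[OF C(3) x(1)]) blast
    have 2: "vs1.representation C x = vs1.representation B x"
      by (rule vs1.representation_extend[OF C(3) xB C(1)])
    have "vs1.representation C x b = 0" for b
      using 1 2 vs1.representation_ne_zero by (metis DiffD2)
    moreover have "x \<in> vs1.span C" using xB C(1) vs1.span_mono by blast
    ultimately show "x = 0"
      using vs1.sum_nonzero_representation_eq[OF C(3)] by fastforce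
  qed
  have indTD: "vs2.independent (T ` ?D)"
    by (rule T.independent_injective_image[OF indD inj])
  have "T ` V \<subseteq> T ` vs1.span C" using C(4) by blast
  also have "\<dots> = vs2.span (T ` C)" by (simp add: T.span_image)
  also have "\<dots> \<subseteq> vs2.span (insert 0 (T ` ?D))" by (rule vs2.span_mono) (use B(1) in blast)
  finally have sp: "T ` V \<subseteq> vs2.span (T ` ?D)" by simp
  have "card (T ` ?D) = vs2.dim (T ` V)"
    by (rule vs2.basis_card_eq_dim[OF _ sp indTD]) (use C(2) in blast)
  moreover have "card (T ` ?D) = card ?D"
    by (rule card_image) (use inj vs1.span_superset in \<open>blast intro: inj_on_subset\<close>)
  moreover have "card C = vs1.dim V" using vs1.basis_card_eq_dim[OF C(2,4,3)] .
  moreover have "card ?D = card C - card B" "card B \<le> card C"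
    using finC C(1) by (simp_all add: card_Diff_subset finite_subset card_mono)
  ultimately show ?thesis using B(4) by simp
qed

section \<open>Forms of fixed degree and tuples of forms\<close>

definition scaleV :: "complex \<Rightarrow> (nat \<Rightarrow> poly3) \<Rightarrow> nat \<Rightarrow> poly3" where
  "scaleV c v = (\<lambda>i. scale3 c (v i))"

lemma vector_space_scale3: "vector_space scale3"
proof
  show "scale3 (a + b) x = scale3 a x + scale3 b x" for a b x
    by (rule poly_mapping_eqI) (simp add: scale3_eq lookup_const3_mult lookup_add distrib_right)
qed (simp_all add: scale3_eq distrib_left const3_mult flip: mult.assoc)

interpretation S: vector_space scale3 by (rule vector_space_scale3)

interpretation V: vector_space scaleV
  by standard (auto simp: scaleV_def fun_eq_iff S.scale_right_distrib S.scale_left_distrib)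

interpretation SV: vector_space_pair scale3 scaleV ..
interpretation VS: vector_space_pair scaleV scale3 ..
interpretation VV: vector_space_pair scaleV scaleV ..

lemma finite_mdeg: "finite {m. mdeg m = k}"
  by (rule finite_subset[of _ "{..k} \<times> {..k} \<times> {..k}"]) (auto simp: mdeg_def)

text \<open>Triples correspond to pairs with a + b at most \<open>k\<close>, counted by a triangular
  number. The factor 2 avoids a division; dimensions are doubled below for the same reason.\<close>

lemma card_mdeg: "2 * card {m. mdeg m = k} = (k + 1) * (k + 2)"
proof -
  have "bij_betw (\<lambda>(a,b). (a, b, k - a - b)) (SIGMA a:{..k}. {..k - a}) {m. mdeg m = k}"
    by (rule bij_betw_byWitness[where f' = "\<lambda>(a,b,c). (a,b)"]) (auto simp: mdeg_def)
  then have "card {m. mdeg m = k} = card (SIGMA a:{..k}. {..k - a})"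
    by (simp add: bij_betw_same_card)
  also have "\<dots> = (\<Sum>a\<le>k. Suc (k - a))" by simp
  also have "\<dots> = (\<Sum>i\<le>k. Suc i)"
    by (rule sum.reindex_bij_witness[of _ "\<lambda>i. k - i" "\<lambda>i. k - i"]) auto
  also have "2 * \<dots> = (k + 1) * (k + 2)" by (induction k) auto
  finally show ?thesis .
qed

definition monomials :: "nat \<Rightarrow> poly3 set" where "monomials k = (\<lambda>m. sg m 1) ` {m. mdeg m = k}"

lemma finite_monomials: "finite (monomials k)" by (simp add: monomials_def finite_mdeg)

lemma homog_subset_span: "{p. homog k p} \<subseteq> S.span (monomials k)"
proof
  fix p assume "p \<in> {p. homog k p}"
  then have "sg m (lk p m) \<in> S.span (monomials k)" if "m \<in> ks p" for m
  proof -
    have sc: "sg m (lk p m) = scale3 (lk p m) (sg m 1)"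
      by (simp add: scale3_def)
    have "mdeg m = k" using that \<open>p \<in> _\<close> by (auto simp: homog_def)
    then have "sg m 1 \<in> monomials k" by (simp add: monomials_def)
    then show ?thesis unfolding sc by (intro S.span_scale S.span_base)
  qed
  then have "(\<Sum>m\<in>ks p. sg m (lk p m)) \<in> S.span (monomials k)" by (rule S.span_sum)
  then show "p \<in> S.span (monomials k)" using poly3_eq_sum_singles[of p] by simp
qed

lemma subspace_homog: "S.subspace {p. homog k p}"
  by (rule S.subspaceI) (simp_all add: scale3_eq homog_iff lookup_const3_mult lookup_add)

lemma dim_homog: "2 * S.dim {p. homog k p} = (k + 1) * (k + 2)"
proof -
  have inj: "inj_on (\<lambda>m. sg m (1::complex)) A" for A
    by (rule inj_onI) (metis keys_single singleton_inject zero_neq_one)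
  have "S.independent (monomials k)"
  proof (rule S.independent_if_scalars_zero[OF finite_monomials])
    fix g x assume z: "(\<Sum>x\<in>monomials k. scale3 (g x) x) = 0" and "x \<in> monomials k"
    then obtain m where m: "x = sg m 1" "mdeg m = k" by (auto simp: monomials_def)
    have "0 = lk (\<Sum>x\<in>monomials k. scale3 (g x) x) m" by (simp add: z)
    also have "\<dots> = (\<Sum>n\<in>{m. mdeg m = k}. g (sg n 1) * lk (sg n 1) m)"
      unfolding monomials_def by (subst sum.reindex[OF inj]) (simp add: lookup_sum scale3_eq lookup_const3_mult)
    also have "\<dots> = (\<Sum>n\<in>{m. mdeg m = k}. if n = m then g (sg m 1) else 0)"
      by (rule sum.cong) (auto simp: lookup_single when_def)
    also have "\<dots> = g x" using m by (simp add: finite_mdeg)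
    finally show "g x = 0" by simp
  qed
  moreover have "monomials k \<subseteq> {p. homog k p}" by (auto simp: monomials_def homog_single)
  ultimately have "card (monomials k) = S.dim {p. homog k p}"
    using homog_subset_span by (intro S.basis_card_eq_dim) auto
  moreover have "card (monomials k) = card {m. mdeg m = k}" unfolding monomials_def by (rule card_image[OF inj])
  ultimately show ?thesis using card_mdeg[of k] by metis
qed

text \<open>Tuples of every length share one type, functions on the naturals that vanish from
  \<open>n\<close> on. Each component has its own degree, as in a sum of shifted copies of the
  ring.\<close>

definition htup :: "nat \<Rightarrow> (nat \<Rightarrow> nat) \<Rightarrow> (nat \<Rightarrow> poly3) set" where
  "htup n D = {v. (\<forall>i<n. homog (D i) (v i)) \<and> (\<forall>i\<ge>n. v i = 0)}"

lemma subspace_htup: "V.subspace (htup n D)"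
  by (rule V.subspaceI)
    (simp_all add: htup_def scaleV_def scale3_eq homog_iff lookup_const3_mult lookup_add)

definition tup_single :: "nat \<Rightarrow> poly3 \<Rightarrow> nat \<Rightarrow> poly3" where
  "tup_single i p = (\<lambda>j. if j = i then p else 0)"

lemma linear_tup_single: "Vector_Spaces.linear scale3 scaleV (tup_single i)"
  by standard (auto simp: tup_single_def scaleV_def fun_eq_iff)

lemma linear_component: "Vector_Spaces.linear scaleV scale3 (\<lambda>v. v i)"
  by standard (auto simp: scaleV_def)

text \<open>Supplies the finite spanning set for rank-nullity: each induction step adds the
  monomials of one more coordinate.\<close>

lemma htup_finite_span: "\<exists>B. finite B \<and> htup n D \<subseteq> V.span B"
proof (induction n)
  case 0
  have "htup 0 D = {0}" by (auto simp: htup_def fun_eq_iff)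
  then show ?case by (auto intro!: exI[of _ "{}"])
next
  case (Suc n)
  then obtain B where B: "finite B" "htup n D \<subseteq> V.span B" by blast
  let ?C = "tup_single n ` monomials (D n)"
  interpret L: Vector_Spaces.linear scale3 scaleV "tup_single n" by (rule linear_tup_single)
  have "v \<in> V.span (B \<union> ?C)" if v: "v \<in> htup (Suc n) D" for v
  proof -
    have "v n \<in> S.span (monomials (D n))" using v homog_subset_span[of "D n"] by (auto simp: htup_def)
    then have "tup_single n (v n) \<in> V.span ?C" by (auto simp: L.span_image)
    then have 1: "tup_single n (v n) \<in> V.span (B \<union> ?C)" using V.span_mono by blast
    have "v(n := 0) \<in> htup n D" using v by (auto simp: htup_def)
    then have 2: "v(n := 0) \<in> V.span (B \<union> ?C)" using B(2) V.span_mono by blast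
    have "v = v(n := 0) + tup_single n (v n)" by (auto simp: tup_single_def)
    then show ?thesis using 1 2 V.span_add by metis
  qed
  then show ?case using B(1) finite_monomials by (intro exI[of _ "B \<union> ?C"]) auto
qed

lemma dim_htup_kernel_image:
  assumes "Vector_Spaces.linear scaleV scaleV T"
  shows "V.dim (htup n D) = V.dim {v \<in> htup n D. T v = 0} + V.dim (T ` htup n D)"
  using htup_finite_span[of n D] VV.dim_eq_kernel_plus_image[OF assms subspace_htup] by blast

lemma dim_htup_kernel_image_S:
  assumes "Vector_Spaces.linear scaleV scale3 T"
  shows "V.dim (htup n D) = V.dim {v \<in> htup n D. T v = 0} + S.dim (T ` htup n D)"
  using htup_finite_span[of n D] VS.dim_eq_kernel_plus_image[OF assms subspace_htup] by blast

lemma dim_homog_kernel_image: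
  assumes "Vector_Spaces.linear scale3 scaleV T"
  shows "S.dim {p. homog k p} = S.dim {p. homog k p \<and> T p = 0} + V.dim (T ` {p. homog k p})"
  using SV.dim_eq_kernel_plus_image[OF assms subspace_homog finite_monomials homog_subset_span] by simp

text \<open>Rank-nullity for the projection to coordinate \<open>n\<close>, whose kernel is the
  piece with one coordinate fewer.\<close>

lemma dim_htup: "V.dim (htup n D) = (\<Sum>i<n. S.dim {p. homog (D i) p})"
proof (induction n)
  case 0
  have "htup 0 D = {0}" by (auto simp: htup_def fun_eq_iff)
  then show ?case using V.dim_le_card[of "{0}" "{}"] by simp
next
  case (Suc n)
  have "{v \<in> htup (Suc n) D. v n = 0} = htup n D"
    by (auto simp: htup_def less_Suc_eq Suc_le_eq dest: le_neq_implies_less)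
  moreover have "(\<lambda>v. v n) ` htup (Suc n) D = {p. homog (D n) p}"
  proof (intro equalityI subsetI)
    fix p assume "p \<in> {p. homog (D n) p}"
    then have "tup_single n p \<in> htup (Suc n) D" by (auto simp: htup_def tup_single_def)
    then show "p \<in> (\<lambda>v. v n) ` htup (Suc n) D" by (rule rev_image_eqI) (simp add: tup_single_def)
  qed (auto simp: htup_def)
  ultimately show ?case
    using dim_htup_kernel_image_S[OF linear_component[of n], of "Suc n" D] Suc by simp
qed

section \<open>Freeness of the syzygy module\<close>

text \<open>Here \<open>P\<close> will select the monomials that survive modulo x or modulo (x, y);
  the surviving part of \<open>p\<close> is divided by \<open>m\<close>, and the rest is kept in
  \<open>p'\<close>.\<close>

lemma split_factor:
  assumes "\<And>n. P n \<Longrightarrow> lk p n \<noteq> 0 \<Longrightarrow> \<exists>k. n = m + k"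
  shows "\<exists>p' w. p = p' + sg m 1 * w \<and> (\<forall>n. P n \<longrightarrow> lk p' n = 0) \<and>
    (\<forall>k. P (m + k) \<longrightarrow> lk w k = lk p (m + k))"
proof -
  have "\<exists>k. n = m + k" if "lk (restr P p) n \<noteq> 0" for n
    using that assms[of n] by (simp add: lookup_restr split: if_splits)
  then obtain w where w: "restr P p = sg m 1 * w" "\<And>k. lk w k = lk (restr P p) (m + k)"
    using single_mult_factor by metis
  show ?thesis
  proof (intro exI conjI allI impI)
    show "p = restr (\<lambda>n. \<not> P n) p + sg m 1 * w"
      unfolding w(1)[symmetric] by (rule poly_mapping_eqI) (simp add: lookup_add lookup_restr)
  qed (simp_all add: lookup_restr w(2))
qed

lemma single_1_neq_0: "sg m 1 \<noteq> 0"
  by (metis keys_single keys_zero insert_not_empty zero_neq_one)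

text \<open>Membership in the ideal (x), and next in (x, y), is stated as vanishing of coefficients,
  which is evidently a linear condition; \<open>inX_iff\<close> and \<open>inXY_iff\<close> recover
  the ideals.\<close>

definition inX :: "poly3 \<Rightarrow> bool" where "inX q \<longleftrightarrow> (\<forall>b c. lk q (0,b,c) = 0)"
definition inXY :: "poly3 \<Rightarrow> bool" where "inXY q \<longleftrightarrow> (\<forall>c. lk q (0,0,c) = 0)"

lemma lookup_varX_mult_0 [simp]: "lk (varX * q) (0,b,c) = 0"
  unfolding varX_def by (rule lookup_single_mult_0) auto

lemma lookup_varY_mult_0 [simp]: "lk (varY * q) (a,0,c) = 0"
  unfolding varY_def by (rule lookup_single_mult_0) auto

lemma lookup_varY_mult_Suc [simp]: "lk (varY * q) (a,Suc b,c) = lk q (a,b,c)"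
  using lookup_single_mult[of "(0,1,0)" 1 q "(a,b,c)"] by (simp add: varY_def)

lemma inX_iff: "inX q \<longleftrightarrow> (\<exists>w. q = varX * w)"
proof
  assume q: "inX q"
  have "\<exists>k. n = (1,0,0) + k" if "lk q n \<noteq> 0" for n
  proof -
    obtain a b c where n: "n = (a,b,c)" by (cases n)
    with that q have "n = (1,0,0) + (a - 1,b,c)" by (cases a) (auto simp: inX_def)
    then show ?thesis ..
  qed
  then show "\<exists>w. q = varX * w" unfolding varX_def by (metis single_mult_factor)
qed (auto simp: inX_def)

lemma inXY_iff: "inXY q \<longleftrightarrow> (\<exists>v w. q = varX * v + varY * w)"
proof
  assume q: "inXY q"
  have "\<exists>k. n = (0,1,0) + k" if "fst n = 0" "lk q n \<noteq> 0" for n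
  proof -
    obtain a b c where n: "n = (a,b,c)" by (cases n)
    with that q have "n = (0,1,0) + (a,b - 1,c)" by (cases b) (auto simp: inXY_def)
    then show ?thesis ..
  qed
  from split_factor[of "\<lambda>n. fst n = 0" q "(0,1,0)", OF this]
  obtain p' w where "q = p' + sg (0,1,0) 1 * w" and p': "\<And>n. fst n = 0 \<Longrightarrow> lk p' n = 0" by blast
  moreover obtain v where "p' = varX * v"
    using inX_iff[of p'] p' by (auto simp: inX_def)
  ultimately show "\<exists>v w. q = varX * v + varY * w" unfolding varY_def by blast
qed (auto simp: inXY_def lookup_add)

lemma inX_mult: "inX p \<Longrightarrow> inX (p * q)"
  by (auto simp: inX_iff mult.assoc)

lemma inX_diff: "inX p \<Longrightarrow> inX q \<Longrightarrow> inX (p - q)"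
  by (simp add: inX_def lookup_minus)

lemma inX_sum: "(\<And>i. i \<in> A \<Longrightarrow> inX (g i)) \<Longrightarrow> inX (sum g A)"
  by (simp add: inX_def lookup_sum)

lemma inXY_mult: "inXY p \<Longrightarrow> inXY (p * q)"
  unfolding inXY_iff
proof (elim exE)
  fix v w assume "p = varX * v + varY * w"
  then have "p * q = varX * (v * q) + varY * (w * q)" by (simp add: distrib_right mult.assoc)
  then show "\<exists>v w. p * q = varX * v + varY * w" by blast
qed

lemma inXY_diff: "inXY p \<Longrightarrow> inXY q \<Longrightarrow> inXY (p - q)"
  by (simp add: inXY_def lookup_minus)

lemma inXY_sum: "(\<And>i. i \<in> A \<Longrightarrow> inXY (g i)) \<Longrightarrow> inXY (sum g A)"
  by (simp add: inXY_def lookup_sum)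

lemma inX_imp_inXY: "inX p \<Longrightarrow> inXY p"
  by (simp add: inX_def inXY_def)

lemma inXY_cancel_Z: "inXY (sg (0,0,k) 1 * q) \<Longrightarrow> inXY q"
  unfolding inXY_def using lookup_single_mult[of "(0,0,k)" 1 q "(0,0,_)"] by simp

lemma inX_cancel_Y: "inX (sg (0,k,0) 1 * q) \<Longrightarrow> inX q"
  unfolding inX_def using lookup_single_mult[of "(0,k,0)" 1 q "(0,_,_)"] by simp

section \<open>Independence of minimal relations by reduction modulo x, y and z\<close>

text \<open>\<open>G\<close>, \<open>R\<close> and \<open>u\<close> are the maps of S^n -> S^m ->
  S^3 -> S; \<open>exact_D\<close> and \<open>exact_K\<close> are exactness at S^3 and S^m, and
  \<open>irred\<close> is minimality on the left. Injectivity of the leftmost map is the content of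
  \<open>G_independent\<close>.\<close>

locale graded_resolution =
  fixes u :: "nat \<Rightarrow> poly3" and R G :: "nat \<Rightarrow> nat \<Rightarrow> poly3" and m n r e :: nat and eps :: "nat \<Rightarrow> nat"
  assumes exact_D: "(\<Sum>i<3. v i * u i) = 0 \<longleftrightarrow> (\<exists>h. \<forall>i<3. v i = (\<Sum>j<m. h j * R j i))"
    and exact_K: "(\<forall>i<3. (\<Sum>j<m. h j * R j i) = 0) \<longleftrightarrow> (\<exists>c. \<forall>j<m. h j = (\<Sum>l<n. c l * G l j))"
    and homog_u: "i < 3 \<Longrightarrow> homog e (u i)"
    and homog_R: "j < m \<Longrightarrow> i < 3 \<Longrightarrow> homog r (R j i)"
    and homog_G: "l < n \<Longrightarrow> j < m \<Longrightarrow> homog (eps l) (G l j)"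
    and irred: "l < n \<Longrightarrow> \<not> (\<exists>c. \<forall>j<m. G l j = (\<Sum>l'\<in>{..<n} - {l}. c l' * G l' j))"
begin

text \<open>Graded Nakayama: if \<open>h l0\<close> had a nonzero constant term, the part of the
  relation in degree \<open>eps l0\<close> could be solved for generator \<open>l0\<close>, against
  irredundance.\<close>

lemma relation_no_constant:
  assumes rel: "\<And>j. j < m \<Longrightarrow> (\<Sum>l<n. h l * G l j) = 0" and l0: "l0 < n"
  shows "lk (h l0) (0,0,0) = 0"
proof (rule ccontr)
  assume nz: "lk (h l0) (0,0,0) \<noteq> 0" (is "?c \<noteq> 0")
  \<comment> \<open>Picks from \<open>h l\<close> the component that lands in degree
    \<open>eps l0\<close>; a generator of larger degree contributes nothing.\<close>
  define q where "q l = (if eps l \<le> eps l0 then hcomp (eps l0 - eps l) (h l) else 0)" for l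
  have q0: "q l0 = const3 ?c"
    unfolding q_def
    by (rule poly_mapping_eqI) (auto simp: lookup_hcomp const3_def lookup_single when_def mdeg_def)
  have "\<exists>c. \<forall>j<m. G l0 j = (\<Sum>l'\<in>{..<n} - {l0}. c l' * G l' j)"
  proof (intro exI allI impI)
    fix j assume j: "j < m"
    have "0 = hcomp (eps l0) (\<Sum>l<n. h l * G l j)" by (simp add: rel[OF j])
    also have "\<dots> = (\<Sum>l<n. q l * G l j)"
      unfolding hcomp_sum
      by (rule sum.cong) (auto simp: q_def hcomp_mult_homog[OF homog_G] j)
    also have "\<dots> = const3 ?c * G l0 j + (\<Sum>l\<in>{..<n} - {l0}. q l * G l j)"
      using l0 by (subst sum.remove[of _ l0]) (auto simp: q0)
    finally have "const3 ?c * G l0 j = - (\<Sum>l\<in>{..<n} - {l0}. q l * G l j)"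
      unfolding eq_neg_iff_add_eq_0 by (rule sym)
    then have "const3 (1 / ?c) * (const3 ?c * G l0 j) = const3 (1 / ?c) * - (\<Sum>l\<in>{..<n} - {l0}. q l * G l j)"
      by simp
    moreover have "const3 (1 / ?c) * (const3 ?c * G l0 j) = G l0 j"
      using nz by (simp add: const3_mult flip: mult.assoc)
    ultimately show "G l0 j = (\<Sum>l'\<in>{..<n} - {l0}. (const3 (1 / ?c) * - q l') * G l' j)"
      by (simp add: sum_distrib_left sum_negf mult.assoc)
  qed
  then show False using irred[OF l0] by blast
qed

text \<open>
  If \<open>v = x a + y b\<close> is a syzygy, then \<open>x \<rho>(a) = - y \<rho>(b)\<close> for the map \<open>\<rho>\<close> given by \<open>R\<close>, so
  \<open>\<rho>(b) = x w\<close> and \<open>\<rho>(a) = - y w\<close>. As \<open>x w\<close> annihilates \<open>u\<close>, so does \<open>w\<close>, hence \<open>w = \<rho>(k)\<close> and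
  \<open>v = x (a + y k) + y (b - x k)\<close> with both brackets syzygies.
\<close>

lemma relation_mod_XY_lift:
  assumes v: "\<And>j. j < m \<Longrightarrow> (\<Sum>l<n. h l * G l j) = varX * a j + varY * b j"
  shows "\<exists>c. (\<forall>l. inXY (c l)) \<and> (\<forall>j<m. (\<Sum>l<n. h l * G l j) = (\<Sum>l<n. c l * G l j))"
proof -
  define \<rho> where "\<rho> a i = (\<Sum>j<m. a j * R j i)" for a i
  have "\<forall>i<3. (\<Sum>j<m. (varX * a j + varY * b j) * R j i) = 0"
    unfolding exact_K using v by metis
  then have ab: "varX * \<rho> a i + varY * \<rho> b i = 0" if "i < 3" for i
    using that by (simp add: \<rho>_def sum_distrib_left sum.distrib distrib_right mult.assoc)
  have "inX (\<rho> b i)" if i: "i < 3" for i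
    unfolding inX_def
  proof (intro allI)
    fix y z
    have "lk (varX * \<rho> a i + varY * \<rho> b i) (0,Suc y,z) = 0" by (simp add: ab[OF i])
    then show "lk (\<rho> b i) (0,y,z) = 0" by (simp add: lookup_add)
  qed
  then obtain w where w: "\<And>i. i < 3 \<Longrightarrow> \<rho> b i = varX * w i" unfolding inX_iff by metis
  have X0: "varX \<noteq> 0" unfolding varX_def by (rule single_1_neq_0)
  have "varX * (\<rho> a i + varY * w i) = 0" if "i < 3" for i
    using ab[OF that] w[OF that] by (simp add: algebra_simps)
  then have aw: "\<rho> a i + varY * w i = 0" if "i < 3" for i
    using X0 that poly3_mult_eq_0 by blast
  have "(\<Sum>i<3. \<rho> b i * u i) = 0" unfolding exact_D \<rho>_def by blast
  then have "varX * (\<Sum>i<3. w i * u i) = 0" using w by (simp add: sum_distrib_left mult.assoc)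
  then have "(\<Sum>i<3. w i * u i) = 0" using X0 poly3_mult_eq_0 by blast
  then obtain k where k: "\<And>i. i < 3 \<Longrightarrow> w i = \<rho> k i" unfolding exact_D \<rho>_def by blast
  have "\<forall>i<3. (\<Sum>j<m. (b j - varX * k j) * R j i) = 0"
    using w k by (simp add: left_diff_distrib sum_subtractf mult.assoc \<rho>_def flip: sum_distrib_left)
  then obtain c2 where c2: "\<And>j. j < m \<Longrightarrow> b j - varX * k j = (\<Sum>l<n. c2 l * G l j)"
    unfolding exact_K by blast
  have "\<forall>i<3. (\<Sum>j<m. (a j + varY * k j) * R j i) = 0"
    using aw k by (simp add: distrib_right sum.distrib mult.assoc \<rho>_def flip: sum_distrib_left)
  then obtain c1 where c1: "\<And>j. j < m \<Longrightarrow> a j + varY * k j = (\<Sum>l<n. c1 l * G l j)"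
    unfolding exact_K by blast
  show ?thesis
  proof (intro exI[of _ "\<lambda>l. varX * c1 l + varY * c2 l"] conjI allI impI)
    fix j assume j: "j < m"
    have "(\<Sum>l<n. h l * G l j) = varX * (a j + varY * k j) + varY * (b j - varX * k j)"
      by (simp add: v[OF j] algebra_simps)
    also have "\<dots> = (\<Sum>l<n. (varX * c1 l + varY * c2 l) * G l j)"
      unfolding c1[OF j] c2[OF j] by (simp add: sum_distrib_left distrib_right sum.distrib mult.assoc)
    finally show "(\<Sum>l<n. h l * G l j) = (\<Sum>l<n. (varX * c1 l + varY * c2 l) * G l j)" .
  qed (auto simp: inXY_iff)
qed

text \<open>The lifted coefficients \<open>c\<close> lie in (x, y), so \<open>h - c\<close> is a
  true relation with the same constant terms as \<open>h\<close>.\<close>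

lemma relation_mod_XY_no_constant:
  assumes rel: "\<And>j. j < m \<Longrightarrow> inXY (\<Sum>l<n. h l * G l j)" and l: "l < n"
  shows "lk (h l) (0,0,0) = 0"
proof -
  have "\<forall>j. \<exists>v w. j < m \<longrightarrow> (\<Sum>l<n. h l * G l j) = varX * v + varY * w"
    using rel unfolding inXY_iff by blast
  from choice[OF this] obtain a
    where "\<forall>j. \<exists>w. j < m \<longrightarrow> (\<Sum>l<n. h l * G l j) = varX * a j + varY * w" by blast
  from choice[OF this] obtain b
    where ab: "\<And>j. j < m \<Longrightarrow> (\<Sum>l<n. h l * G l j) = varX * a j + varY * b j" by blast
  from relation_mod_XY_lift[of h a b, OF ab] obtain c
    where c: "\<And>l. inXY (c l)" "\<And>j. j < m \<Longrightarrow> (\<Sum>l<n. h l * G l j) = (\<Sum>l<n. c l * G l j)" by blast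
  have "lk (h l - c l) (0,0,0) = 0"
    by (rule relation_no_constant[of "\<lambda>l. h l - c l", OF _ l])
      (simp only: left_diff_distrib sum_subtractf c diff_self)
  then show ?thesis using c(1)[of l] by (simp add: lookup_minus inXY_def)
qed

text \<open>Modulo (x, y) only powers of z remain. Once the coefficients below z^k vanish, z^k can
  be cancelled; the quotients again satisfy the hypothesis, and their constant terms are the
  coefficients at z^k.\<close>

lemma relation_mod_XY:
  assumes rel: "\<And>j. j < m \<Longrightarrow> inXY (\<Sum>l<n. h l * G l j)" and l: "l < n"
  shows "inXY (h l)"
proof -
  have "\<forall>l<n. lk (h l) (0,0,k) = 0" for k
  proof (induction k rule: less_induct)
    case (less k)
    have "\<exists>p' w. h l = p' + sg (0,0,k) 1 * w \<and> inXY p' \<and> lk w (0,0,0) = lk (h l) (0,0,k)" if l: "l < n" for l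
    proof -
      have "\<exists>y. x = (0,0,k) + y" if "fst x = 0 \<and> fst (snd x) = 0" "lk (h l) x \<noteq> 0" for x
      proof -
        define c where "c = snd (snd x)"
        have x: "x = (0,0,c)" using that(1) by (simp add: prod_eq_iff c_def)
        then have "\<not> c < k" using less l that(2) by auto
        then have "x = (0,0,k) + (0,0,c - k)" by (simp add: x)
        then show ?thesis ..
      qed
      from split_factor[of "\<lambda>x. fst x = 0 \<and> fst (snd x) = 0" "h l" "(0,0,k)", OF this]
      obtain p' w where "h l = p' + sg (0,0,k) 1 * w"
        "\<And>x. fst x = 0 \<and> fst (snd x) = 0 \<Longrightarrow> lk p' x = 0"
        "\<And>y. fst ((0,0,k) + y) = 0 \<and> fst (snd ((0,0,k) + y)) = 0 \<Longrightarrow> lk w y = lk (h l) ((0,0,k) + y)"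
        by blast
      from this(1,2) this(3)[of "(0,0,0)"] show ?thesis
        by (intro exI[of _ p'] exI[of _ w]) (auto simp: inXY_def)
    qed
    then obtain p w where pw: "\<And>l. l < n \<Longrightarrow> h l = p l + sg (0,0,k) 1 * w l"
      "\<And>l. l < n \<Longrightarrow> inXY (p l)" "\<And>l. l < n \<Longrightarrow> lk (w l) (0,0,0) = lk (h l) (0,0,k)" by metis
    have "inXY (\<Sum>l<n. w l * G l j)" if j: "j < m" for j
    proof (rule inXY_cancel_Z)
      have "(\<Sum>l<n. h l * G l j) = (\<Sum>l<n. p l * G l j) + sg (0,0,k) 1 * (\<Sum>l<n. w l * G l j)"
        using pw(1) by (simp add: distrib_right sum.distrib sum_distrib_left mult.assoc)
      then have "sg (0,0,k) 1 * (\<Sum>l<n. w l * G l j) = (\<Sum>l<n. h l * G l j) - (\<Sum>l<n. p l * G l j)"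
        by simp
      moreover have "inXY (\<Sum>l<n. p l * G l j)" using pw(2) by (intro inXY_sum inXY_mult) auto
      ultimately show "inXY (sg (0,0,k) 1 * (\<Sum>l<n. w l * G l j))"
        using inXY_diff[OF rel[OF j]] by simp
    qed
    then show ?case using relation_mod_XY_no_constant[of w] pw(3) by simp
  qed
  then show ?thesis using l by (simp add: inXY_def)
qed

text \<open>The same with powers of y: after cancelling y^k the relation holds modulo x, hence
  modulo (x, y), and \<open>relation_mod_XY\<close> kills the terms of the quotient free of x and y.
  These are the terms of \<open>h l\<close> with y^k and no x.\<close>

lemma relation_mod_X:
  assumes rel: "\<And>j. j < m \<Longrightarrow> inX (\<Sum>l<n. h l * G l j)" and l: "l < n"
  shows "inX (h l)"
proof -
  have "\<forall>l<n. \<forall>c. lk (h l) (0,k,c) = 0" for k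
  proof (induction k rule: less_induct)
    case (less k)
    have "\<exists>p' w. h l = p' + sg (0,k,0) 1 * w \<and> inX p' \<and> (\<forall>c. lk w (0,0,c) = lk (h l) (0,k,c))" if l: "l < n" for l
    proof -
      have "\<exists>y. x = (0,k,0) + y" if "fst x = 0" "lk (h l) x \<noteq> 0" for x
      proof -
        define b c where "b = fst (snd x)" and "c = snd (snd x)"
        have x: "x = (0,b,c)" using that(1) by (simp add: prod_eq_iff b_def c_def)
        then have "\<not> b < k" using less l that(2) by auto
        then have "x = (0,k,0) + (0,b - k,c)" by (simp add: x)
        then show ?thesis ..
      qed
      from split_factor[of "\<lambda>x. fst x = 0" "h l" "(0,k,0)", OF this]
      obtain p' w where "h l = p' + sg (0,k,0) 1 * w"
        "\<And>x. fst x = 0 \<Longrightarrow> lk p' x = 0"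
        "\<And>y. fst ((0,k,0) + y) = 0 \<Longrightarrow> lk w y = lk (h l) ((0,k,0) + y)"
        by blast
      from this(1,2) this(3)[of "(0,0,_)"] show ?thesis
        by (intro exI[of _ p'] exI[of _ w]) (auto simp: inX_def)
    qed
    then obtain p w where pw: "\<And>l. l < n \<Longrightarrow> h l = p l + sg (0,k,0) 1 * w l"
      "\<And>l. l < n \<Longrightarrow> inX (p l)" "\<And>l c. l < n \<Longrightarrow> lk (w l) (0,0,c) = lk (h l) (0,k,c)" by metis
    have "inX (\<Sum>l<n. w l * G l j)" if j: "j < m" for j
    proof (rule inX_cancel_Y)
      have "(\<Sum>l<n. h l * G l j) = (\<Sum>l<n. p l * G l j) + sg (0,k,0) 1 * (\<Sum>l<n. w l * G l j)"
        using pw(1) by (simp add: distrib_right sum.distrib sum_distrib_left mult.assoc)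
      then have "sg (0,k,0) 1 * (\<Sum>l<n. w l * G l j) = (\<Sum>l<n. h l * G l j) - (\<Sum>l<n. p l * G l j)"
        by simp
      moreover have "inX (\<Sum>l<n. p l * G l j)" using pw(2) by (intro inX_sum inX_mult) auto
      ultimately show "inX (sg (0,k,0) 1 * (\<Sum>l<n. w l * G l j))"
        using inX_diff[OF rel[OF j]] by simp
    qed
    then have "inXY (w l)" if "l < n" for l
      by (rule relation_mod_XY[of w l, OF inX_imp_inXY that])
    then show ?case using pw(3) by (simp add: inXY_def)
  qed
  then show ?thesis using l by (simp add: inX_def)
qed

text \<open>The last round, with powers of x: the quotients by x^k satisfy an exact relation, so
  \<open>relation_mod_X\<close> makes them divisible by x again.\<close>

lemma G_independent:
  assumes rel: "\<And>j. j < m \<Longrightarrow> (\<Sum>l<n. h l * G l j) = 0" and l: "l < n"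
  shows "h l = 0"
proof -
  have "\<forall>l<n. \<forall>b c. lk (h l) (k,b,c) = 0" for k
  proof (induction k rule: less_induct)
    case (less k)
    have "\<exists>w. h l = sg (k,0,0) 1 * w \<and> (\<forall>y. lk w y = lk (h l) ((k,0,0) + y))" if l: "l < n" for l
    proof -
      have "\<exists>y. x = (k,0,0) + y" if "lk (h l) x \<noteq> 0" for x
      proof -
        obtain a b c where x: "x = (a,b,c)" by (cases x)
        then have "\<not> a < k" using less l that by auto
        then have "x = (k,0,0) + (a - k,b,c)" by (simp add: x)
        then show ?thesis ..
      qed
      then show ?thesis by (metis single_mult_factor)
    qed
    then obtain w where w: "\<And>l. l < n \<Longrightarrow> h l = sg (k,0,0) 1 * w l"
      "\<And>l y. l < n \<Longrightarrow> lk (w l) y = lk (h l) ((k,0,0) + y)" by metis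
    have z: "(\<Sum>l<n. w l * G l j) = 0" if j: "j < m" for j
    proof -
      have "sg (k,0,0) 1 * (\<Sum>l<n. w l * G l j) = (\<Sum>l<n. h l * G l j)"
        using w(1) by (simp add: sum_distrib_left mult.assoc)
      then show ?thesis by (simp add: rel[OF j] poly3_mult_eq_0 single_1_neq_0)
    qed
    have wX: "inX (w l)" if "l < n" for l
      by (rule relation_mod_X[of w l, OF _ that]) (simp add: z inX_def)
    show ?case
    proof (intro allI impI)
      fix l b c assume l: "l < n"
      have "lk (h l) ((k,0,0) + (0,b,c)) = lk (w l) (0,b,c)" by (simp only: w(2)[OF l])
      then show "lk (h l) (k,b,c) = 0" using wX[OF l] by (simp add: inX_def)
    qed
  qed
  then have "lk (h l) x = 0" for x using l by (cases x) blast
  then show ?thesis by (intro poly_mapping_eqI) simp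
qed

end

section \<open>The Hilbert function of the Milnor algebra\<close>

lemma linear_comb_tuple:
  "Vector_Spaces.linear scaleV scaleV (\<lambda>h i. if i < n then \<Sum>j<m. h j * A j i else 0)"
  by standard (auto simp: scaleV_def scale3_eq fun_eq_iff distrib_right sum.distrib sum_distrib_left mult.assoc)

lemma linear_comb:
  "Vector_Spaces.linear scaleV scale3 (\<lambda>h. \<Sum>j<m. h j * a j)"
  by standard (auto simp: scaleV_def scale3_eq distrib_right sum.distrib sum_distrib_left mult.assoc)

lemma dim_zero_set: "V.dim {0} = 0" "S.dim {0} = 0"
  using V.dim_le_card[of "{0}" "{}"] S.dim_le_card[of "{0}" "{}"] by simp_all

abbreviation hdim :: "nat \<Rightarrow> nat" where "hdim k \<equiv> S.dim {p. homog k p}"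

context graded_resolution
begin

definition "syz_piece k = {v \<in> htup m (\<lambda>_. k). \<forall>i<3. (\<Sum>j<m. v j * R j i) = 0}"
definition "D0_piece k = {v \<in> htup 3 (\<lambda>_. k). (\<Sum>i<3. v i * u i) = 0}"
definition "jac_piece k = {p. homog k p \<and> (\<exists>v. p = (\<Sum>i<3. v i * u i))}"

text \<open>By \<open>G_independent\<close> the combination map from the free module is injective.
  The bound on \<open>k\<close> makes every \<open>k - eps l\<close> a true difference.\<close>

lemma dim_syz_piece:
  assumes k: "\<And>l. l < n \<Longrightarrow> eps l \<le> k"
  shows "V.dim (syz_piece k) = (\<Sum>l<n. hdim (k - eps l))"
proof -
  let ?T = "\<lambda>h i. if i < m then \<Sum>l<n. h l * G l i else 0"
  let ?W = "htup n (\<lambda>l. k - eps l)"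
  have "{h \<in> ?W. ?T h = 0} = {0}"
  proof (intro equalityI subsetI)
    fix h assume h: "h \<in> {h \<in> ?W. ?T h = 0}"
    have rel: "(\<Sum>l<n. h l * G l j) = 0" if "j < m" for j
    proof -
      have "?T h j = 0" using h by (simp add: fun_eq_iff)
      then show ?thesis using that by simp
    qed
    have "h l = 0" for l
    proof (cases "l < n")
      case True
      then show ?thesis using G_independent[of h l] rel by blast
    qed (use h in \<open>simp add: htup_def\<close>)
    then show "h \<in> {0}" by (simp add: fun_eq_iff)
  qed (auto simp: htup_def fun_eq_iff)
  moreover have "?T ` ?W = syz_piece k"
  proof (intro equalityI subsetI)
    fix v assume "v \<in> ?T ` ?W"
    then obtain h where h: "h \<in> ?W" "v = ?T h" by blast
    have "homog k (v j)" if j: "j < m" for j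
    proof -
      have "homog k (h l * G l j)" if l: "l < n" for l
        using homog_mult[of "k - eps l" "h l" "eps l" "G l j"] h(1) homog_G[OF l j] k[OF l] l
        by (simp add: htup_def)
      then show ?thesis using j by (auto simp: h(2) intro: homog_sum)
    qed
    moreover have "\<forall>i<3. (\<Sum>j<m. v j * R j i) = 0"
      unfolding exact_K h(2) by (rule exI[of _ h]) simp
    ultimately show "v \<in> syz_piece k" by (simp add: syz_piece_def htup_def h(2))
  next
    fix v assume v: "v \<in> syz_piece k"
    then have "\<forall>i<3. (\<Sum>j<m. v j * R j i) = 0" by (simp add: syz_piece_def)
    then obtain c where c: "\<And>j. j < m \<Longrightarrow> v j = (\<Sum>l<n. c l * G l j)" unfolding exact_K by blast
    \<comment> \<open>The coefficients \<open>c\<close> need not be homogeneous; only their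
      components in the right degree contribute to \<open>v\<close>.\<close>
    define h where "h l = (if l < n then hcomp (k - eps l) (c l) else 0)" for l
    have "h \<in> ?W" by (simp add: htup_def h_def)
    moreover have "v = ?T h"
    proof
      fix j
      show "v j = ?T h j"
      proof (cases "j < m")
        case True
        then have "v j = hcomp k (v j)" using v by (simp add: syz_piece_def htup_def hcomp_homog[of k])
        also have "\<dots> = (\<Sum>l<n. hcomp k (c l * G l j))" by (simp add: c[OF True] hcomp_sum)
        also have "\<dots> = (\<Sum>l<n. h l * G l j)"
          by (rule sum.cong) (auto simp: h_def hcomp_mult_homog[OF homog_G] True k)
        finally show ?thesis using True by simp
      qed (use v in \<open>simp add: syz_piece_def htup_def\<close>)
    qed
    ultimately show "v \<in> ?T ` ?W" by blast
  qed
  ultimately show ?thesis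
    using dim_htup_kernel_image[OF linear_comb_tuple[of m G n], of n "\<lambda>l. k - eps l"]
    by (simp add: dim_htup dim_zero_set)
qed

text \<open>Rank-nullity for the map given by \<open>R\<close>: exactness identifies its image with
  the relations among the \<open>u i\<close>.\<close>

lemma dim_D0_piece:
  "V.dim (syz_piece k) + V.dim (D0_piece (k + r)) = m * hdim k"
proof -
  let ?T = "\<lambda>h i. if i < 3 then \<Sum>j<m. h j * R j i else 0"
  let ?W = "htup m (\<lambda>_. k)"
  have "{h \<in> ?W. ?T h = 0} = syz_piece k"
    unfolding syz_piece_def by (auto simp: fun_eq_iff)
  moreover have "?T ` ?W = D0_piece (k + r)"
  proof (intro equalityI subsetI)
    fix v assume "v \<in> ?T ` ?W"
    then obtain h where h: "h \<in> ?W" "v = ?T h" by blast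
    have "homog (k + r) (v i)" if i: "i < 3" for i
    proof -
      have "homog (k + r) (h j * R j i)" if j: "j < m" for j
        using homog_mult[of k "h j" r "R j i"] h(1) homog_R[OF j i] j by (simp add: htup_def)
      then show ?thesis using i by (auto simp: h(2) intro: homog_sum)
    qed
    moreover have "(\<Sum>i<3. v i * u i) = 0"
      unfolding exact_D h(2) by (rule exI[of _ h]) simp
    ultimately show "v \<in> D0_piece (k + r)" by (simp add: D0_piece_def htup_def h(2))
  next
    fix v assume v: "v \<in> D0_piece (k + r)"
    then have "(\<Sum>i<3. v i * u i) = 0" by (simp add: D0_piece_def)
    then obtain c where c: "\<And>i. i < 3 \<Longrightarrow> v i = (\<Sum>j<m. c j * R j i)" unfolding exact_D by blast
    define h where "h j = (if j < m then hcomp k (c j) else 0)" for j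
    have "h \<in> ?W" by (simp add: htup_def h_def)
    moreover have "v = ?T h"
    proof
      fix i
      show "v i = ?T h i"
      proof (cases "i < 3")
        case True
        then have "v i = hcomp (k + r) (v i)" using v by (simp add: D0_piece_def htup_def hcomp_homog[of "k + r"])
        also have "\<dots> = (\<Sum>j<m. hcomp (k + r) (c j * R j i))" by (simp add: c[OF True] hcomp_sum)
        also have "\<dots> = (\<Sum>j<m. h j * R j i)"
          by (rule sum.cong) (auto simp: h_def hcomp_mult_homog[OF homog_R] True)
        finally show ?thesis using True by simp
      qed (use v in \<open>simp add: D0_piece_def htup_def\<close>)
    qed
    ultimately show "v \<in> ?T ` ?W" by blast
  qed
  ultimately show ?thesis
    using dim_htup_kernel_image[OF linear_comb_tuple[of 3 R m], of m "\<lambda>_. k"]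
    by (simp add: dim_htup)
qed

text \<open>Rank-nullity for the map given by \<open>u\<close>, whose kernel is
  \<open>D0_piece k\<close>.\<close>

lemma dim_jac_piece: "V.dim (D0_piece k) + S.dim (jac_piece (k + e)) = 3 * hdim k"
proof -
  let ?T = "\<lambda>v. \<Sum>i<3. v i * u i"
  let ?W = "htup 3 (\<lambda>_. k)"
  have "?T ` ?W = jac_piece (k + e)"
  proof (intro equalityI subsetI)
    fix p assume "p \<in> ?T ` ?W"
    then obtain v where v: "v \<in> ?W" "p = ?T v" by blast
    have "homog (k + e) (v i * u i)" if i: "i < 3" for i
      using homog_mult[of k "v i" e "u i"] v(1) homog_u[OF i] i by (simp add: htup_def)
    then show "p \<in> jac_piece (k + e)" by (auto simp: jac_piece_def v(2) intro: homog_sum)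
  next
    fix p assume p: "p \<in> jac_piece (k + e)"
    then obtain c where c: "p = (\<Sum>i<3. c i * u i)" by (auto simp: jac_piece_def)
    define v where "v i = (if i < 3 then hcomp k (c i) else 0)" for i
    have "v \<in> ?W" by (simp add: htup_def v_def)
    moreover have "p = ?T v"
    proof -
      have "p = hcomp (k + e) p" using p by (simp add: jac_piece_def hcomp_homog[of "k + e"])
      also have "\<dots> = (\<Sum>i<3. hcomp (k + e) (c i * u i))" by (simp add: c hcomp_sum)
      also have "\<dots> = (\<Sum>i<3. v i * u i)"
        by (rule sum.cong) (auto simp: v_def hcomp_mult_homog[OF homog_u])
      finally show ?thesis .
    qed
    ultimately show "p \<in> ?T ` ?W" by blast
  qed
  then show ?thesis
    using dim_htup_kernel_image_S[OF linear_comb[of u 3], of 3 "\<lambda>_. k"]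
    by (simp add: dim_htup D0_piece_def)
qed

end

section \<open>Ideals generated by a regular pair\<close>

text \<open>Koszul complex: as \<open>g\<close> is a nonzerodivisor modulo \<open>f\<close>, all
  relations between \<open>f\<close> and \<open>g\<close> are multiples of the trivial one, (g, -f),
  which \<open>U\<close> parametrises.\<close>

lemma dim_ideal_regular_pair:
  assumes f: "homog d f" "f \<noteq> 0" and g: "homog e g"
    and reg: "\<And>w. f dvd w * g \<Longrightarrow> f dvd w"
    and k: "k \<ge> d + e"
  shows "S.dim {a * f + b * g | a b. homog (k - d) a \<and> homog (k - e) b} + hdim (k - d - e)
    = hdim (k - d) + hdim (k - e)"
proof -
  define F where "F i = (if i = 0 then f else g)" for i :: nat
  define N where "N i = (if i = 0 then k - d else k - e)" for i :: nat
  let ?T = "\<lambda>v. \<Sum>i<2. v i * F i"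
  define U :: "poly3 \<Rightarrow> nat \<Rightarrow> poly3" where "U w = (\<lambda>i. if i = 0 then w * g else if i = 1 then - w * f else 0)" for w
  have T: "?T v = v 0 * f + v 1 * g" for v by (simp add: F_def numeral_2_eq_2)
  have W: "v \<in> htup 2 N \<longleftrightarrow> homog (k - d) (v 0) \<and> homog (k - e) (v 1) \<and> (\<forall>i\<ge>2. v i = 0)" for v
    by (auto simp: htup_def N_def less_2_cases_iff)
  have im: "?T ` htup 2 N = {a * f + b * g | a b. homog (k - d) a \<and> homog (k - e) b}"
  proof (intro equalityI subsetI)
    fix p assume "p \<in> {a * f + b * g | a b. homog (k - d) a \<and> homog (k - e) b}"
    then obtain a b where ab: "p = a * f + b * g" "homog (k - d) a" "homog (k - e) b" by blast
    let ?v = "\<lambda>i. if i = 0 then a else if i = 1 then b else 0"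
    have "?v \<in> htup 2 N" unfolding W using ab by simp
    moreover have "p = ?T ?v" unfolding T using ab by simp
    ultimately show "p \<in> ?T ` htup 2 N" by (rule_tac x = ?v in rev_image_eqI)
  next
    fix p assume "p \<in> ?T ` htup 2 N"
    then obtain v where v: "v \<in> htup 2 N" "p = v 0 * f + v 1 * g" unfolding T by blast
    then show "p \<in> {a * f + b * g | a b. homog (k - d) a \<and> homog (k - e) b}" unfolding W by blast
  qed
  have linU: "Vector_Spaces.linear scale3 scaleV U"
    by standard (auto simp: U_def scaleV_def scale3_eq fun_eq_iff algebra_simps)
  have kU: "{p. homog (k - d - e) p \<and> U p = 0} = {0}"
    using f(2) by (auto simp: U_def fun_eq_iff poly3_mult_eq_0 zero_fun_def dest!: spec[of _ 1])
  have ker: "{v \<in> htup 2 N. ?T v = 0} = U ` {p. homog (k - d - e) p}"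
  proof (intro equalityI subsetI)
    fix v assume v: "v \<in> {v \<in> htup 2 N. ?T v = 0}"
    then have rel: "v 0 * f + v 1 * g = 0" and v1: "homog (k - e) (v 1)" and v2: "\<And>i. i \<ge> 2 \<Longrightarrow> v i = 0"
      unfolding T W by auto
    have "v 1 * g = f * - v 0" using rel by (simp add: eq_neg_iff_add_eq_0 algebra_simps)
    then have "f dvd v 1" using reg by (metis dvd_triv_left)
    then obtain w where w: "v 1 = w * f" by (auto simp: dvd_def mult.commute)
    \<comment> \<open>Only this component of \<open>w\<close> matters, as \<open>v 1\<close> is
      homogeneous; the sign matches the orientation (g, -f) of \<open>U\<close>.\<close>
    define p where "p = - hcomp (k - d - e) w"
    have "v 1 = hcomp (k - e) (v 1)" using v1 by (simp add: hcomp_homog[of "k - e"])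
    also have "\<dots> = hcomp (k - e - d) w * f" unfolding w using k by (subst hcomp_mult_homog[OF f(1)]) auto
    finally have v1p: "v 1 = - p * f" by (simp add: p_def add.commute)
    have "f * (v 0 - p * g) = 0" using rel unfolding v1p by (simp add: algebra_simps)
    then have v0p: "v 0 = p * g" using f(2) by (simp add: poly3_mult_eq_0)
    have "v = U p"
    proof
      fix i show "v i = U p i"
        using v0p v1p v2[of i] by (cases "i = 0 \<or> i = 1") (auto simp: U_def)
    qed
    moreover have "homog (k - d - e) p" unfolding p_def by (rule homog_minus) simp
    ultimately show "v \<in> U ` {p. homog (k - d - e) p}" by blast
  next
    fix v assume "v \<in> U ` {p. homog (k - d - e) p}"
    then obtain p where p: "homog (k - d - e) p" "v = U p" by blast
    have "homog (k - d - e + e) (p * g)" "homog (k - d - e + d) (p * f)"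
      using p f g by (auto intro: homog_mult)
    then have "homog (k - d) (p * g)" "homog (k - e) (- (p * f))" using k by (simp_all add: homog_minus)
    then show "v \<in> {v \<in> htup 2 N. ?T v = 0}" unfolding T W p(2) by (simp add: W T U_def algebra_simps)
  qed
  have "hdim (k - d - e) = V.dim (U ` {p. homog (k - d - e) p})"
    using dim_homog_kernel_image[OF linU, of "k - d - e"] unfolding kU by (simp add: dim_zero_set)
  moreover have "hdim (k - d) + hdim (k - e) = V.dim (htup 2 N)"
    by (simp add: dim_htup N_def numeral_2_eq_2)
  ultimately show ?thesis
    using dim_htup_kernel_image_S[OF linear_comb[of F 2], of 2 N] unfolding ker im by simp
qed

section \<open>Generators and relations as lists\<close>

lemma submod_iff:
  assumes "length v = n"
  shows "v \<in> submod n gs \<longleftrightarrow> (\<exists>h. \<forall>i<n. v ! i = (\<Sum>j<length gs. h j * gs ! j ! i))"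
proof
  assume "v \<in> submod n gs"
  then obtain hs where "v = lincomb n hs gs" by (auto simp: submod_def)
  then show "\<exists>h. \<forall>i<n. v ! i = (\<Sum>j<length gs. h j * gs ! j ! i)"
    by (intro exI[of _ "\<lambda>j. hs ! j"]) (simp add: lincomb_def)
next
  assume "\<exists>h. \<forall>i<n. v ! i = (\<Sum>j<length gs. h j * gs ! j ! i)"
  then obtain h where h: "\<And>i. i < n \<Longrightarrow> v ! i = (\<Sum>j<length gs. h j * gs ! j ! i)" by blast
  have "v = lincomb n (map h [0..<length gs]) gs"
    by (rule nth_equalityI) (simp_all add: lincomb_def assms h)
  then show "v \<in> submod n gs" by (auto simp: submod_def intro!: exI[of _ "map h [0..<length gs]"])
qed

lemma length_submod: "v \<in> submod n gs \<Longrightarrow> length v = n"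
  by (auto simp: submod_def lincomb_def)

lemma sum_remove_nth:
  assumes l: "l < length gs"
  shows "(\<Sum>j<length (take l gs @ drop (Suc l) gs). h (if j < l then j else Suc j) * (take l gs @ drop (Suc l) gs) ! j ! i)
    = (\<Sum>j\<in>{..<length gs} - {l}. h j * gs ! j ! (i::nat))"
  by (rule sum.reindex_bij_witness[of _ "\<lambda>j. if j < l then j else j - 1" "\<lambda>j. if j < l then j else Suc j"])
    (use l in \<open>auto simp: nth_append min_def\<close>)

text \<open>Irredundance speaks of a list with one entry deleted; a sum that omits the index
  \<open>l\<close> avoids the shift of all later indices.\<close>

lemma submod_remove_iff:
  assumes v: "length v = n" and l: "l < length gs"
  shows "v \<in> submod n (take l gs @ drop (Suc l) gs) \<longleftrightarrow>
    (\<exists>h. \<forall>i<n. v ! i = (\<Sum>j\<in>{..<length gs} - {l}. h j * gs ! j ! i))"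
proof -
  let ?g = "take l gs @ drop (Suc l) gs"
  have "(\<exists>h. \<forall>i<n. v ! i = (\<Sum>j<length ?g. h j * ?g ! j ! i)) \<longleftrightarrow>
    (\<exists>h. \<forall>i<n. v ! i = (\<Sum>j<length ?g. h (if j < l then j else Suc j) * ?g ! j ! i))" (is "?A \<longleftrightarrow> ?B")
  proof
    assume ?A
    then obtain h where h: "\<forall>i<n. v ! i = (\<Sum>j<length ?g. h j * ?g ! j ! i)" by blast
    define h' where "h' j = h (if j < l then j else j - 1)" for j
    have "h' (if j < l then j else Suc j) = h j" for j by (simp add: h'_def)
    then show ?B using h by (intro exI[of _ h']) simp
  next
    assume ?B
    then obtain h where h: "\<forall>i<n. v ! i = (\<Sum>j<length ?g. h (if j < l then j else Suc j) * ?g ! j ! i)" by blast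
    show ?A by (rule exI[of _ "\<lambda>j. h (if j < l then j else Suc j)"]) (rule h)
  qed
  then show ?thesis unfolding submod_iff[OF v] sum_remove_nth[OF l] .
qed

text \<open>A nonzero constant coefficient lets generator \<open>j0\<close> be expressed by the
  others, so deleting it leaves a generating list that is too short for minimality.\<close>

lemma minimal_gens_no_unit_relation:
  assumes min: "minimal_gens_D0 f r \<rho>s" and j0: "j0 < length \<rho>s"
    and c0: "c j0 \<noteq> 0"
    and rel: "\<And>i. i < 3 \<Longrightarrow> (\<Sum>j<length \<rho>s. const3 (c j) * \<rho>s ! j ! i) = 0"
  shows False
proof -
  let ?m = "length \<rho>s" and ?gs = "take j0 \<rho>s @ drop (Suc j0) \<rho>s"
  define b where "b j = const3 (- c j / c j0)" for j
  have \<rho>0: "\<rho>s ! j0 ! i = (\<Sum>j\<in>{..<?m} - {j0}. b j * \<rho>s ! j ! i)" if i: "i < 3" for i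
  proof -
    have "const3 (c j0) * \<rho>s ! j0 ! i + (\<Sum>j\<in>{..<?m} - {j0}. const3 (c j) * \<rho>s ! j ! i) = 0"
      using rel[OF i] j0 by (subst (asm) sum.remove[of _ j0]) auto
    then have "const3 (1 / c j0) * (const3 (c j0) * \<rho>s ! j0 ! i) =
        const3 (- 1 / c j0) * (\<Sum>j\<in>{..<?m} - {j0}. const3 (c j) * \<rho>s ! j ! i)"
      by (simp add: eq_neg_iff_add_eq_0[symmetric] const3_def single_uminus)
    then show ?thesis
      using c0 by (simp add: b_def sum_distrib_left const3_mult flip: mult.assoc)
  qed
  have "v \<in> submod 3 ?gs \<longleftrightarrow> v \<in> submod 3 \<rho>s" if v: "length v = 3" for v
    unfolding submod_remove_iff[OF v j0] submod_iff[OF v, of \<rho>s]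
  proof
    assume "\<exists>h. \<forall>i<3. v ! i = (\<Sum>j\<in>{..<?m} - {j0}. h j * \<rho>s ! j ! i)"
    then obtain h where h: "\<forall>i<3. v ! i = (\<Sum>j\<in>{..<?m} - {j0}. h j * \<rho>s ! j ! i)" by blast
    have "(\<Sum>j<?m. (if j = j0 then 0 else h j) * \<rho>s ! j ! i) = (\<Sum>j\<in>{..<?m} - {j0}. h j * \<rho>s ! j ! i)" for i
      using j0 by (subst sum.remove[of _ j0]) (auto intro: sum.cong)
    then show "\<exists>h. \<forall>i<3. v ! i = (\<Sum>j<?m. h j * \<rho>s ! j ! i)"
      using h by (intro exI[of _ "\<lambda>j. if j = j0 then 0 else h j"]) simp
  next
    assume "\<exists>h. \<forall>i<3. v ! i = (\<Sum>j<?m. h j * \<rho>s ! j ! i)"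
    then obtain h where h: "\<And>i. i < 3 \<Longrightarrow> v ! i = (\<Sum>j<?m. h j * \<rho>s ! j ! i)" by blast
    \<comment> \<open>The witness comes from substituting \<open>\<rho>0\<close> for generator
      \<open>j0\<close>.\<close>
    show "\<exists>h. \<forall>i<3. v ! i = (\<Sum>j\<in>{..<?m} - {j0}. h j * \<rho>s ! j ! i)"
    proof (intro exI[of _ "\<lambda>j. h j + h j0 * b j"] allI impI)
      fix i :: nat assume i: "i < 3"
      have "v ! i = h j0 * \<rho>s ! j0 ! i + (\<Sum>j\<in>{..<?m} - {j0}. h j * \<rho>s ! j ! i)"
        using h[OF i] j0 by (subst (asm) sum.remove[of _ j0]) auto
      then show "v ! i = (\<Sum>j\<in>{..<?m} - {j0}. (h j + h j0 * b j) * \<rho>s ! j ! i)"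
        unfolding \<rho>0[OF i] by (simp add: sum_distrib_left distrib_right sum.distrib mult.assoc add.commute)
    qed
  qed
  then have "submod 3 ?gs = submod 3 \<rho>s" using length_submod by blast
  then have "submod 3 ?gs = D0 f" using min by (simp add: minimal_gens_D0_def)
  moreover have "\<forall>g \<in> set ?gs. length g = 3"
    using min unfolding minimal_gens_D0_def by (auto dest: in_set_takeD in_set_dropD)
  ultimately have "?m \<le> length ?gs" using min unfolding minimal_gens_D0_def by blast
  then show False using j0 by simp
qed

section \<open>Bounded quadratic functions and sorted lists\<close>

text \<open>The second difference with step \<open>s\<close> is 2 a s^2 and stays bounded however
  large \<open>s\<close> is, so \<open>a\<close> vanishes; then the first difference b s does the
  same for \<open>b\<close>.\<close>

lemma bounded_quadratic_int:
  fixes a b c M :: int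
  assumes bd: "\<And>j. j \<ge> j0 \<Longrightarrow> 0 \<le> a * int j ^ 2 + b * int j + c \<and> a * int j ^ 2 + b * int j + c \<le> M"
  shows "a = 0 \<and> b = 0"
proof -
  define P where "P j = a * int j ^ 2 + b * int j + c" for j
  have P: "0 \<le> P j" "P j \<le> M" if "j \<ge> j0" for j using bd[OF that] by (simp_all add: P_def)
  have M: "0 \<le> M" using P[of j0] by simp
  \<comment> \<open>Any step beyond 2 M outgrows the bounds on both differences.\<close>
  define s where "s = nat (2 * M + 1)"
  have s: "int s = 2 * M + 1" using M by (simp add: s_def)
  have le: "int s \<le> int s ^ 2" using s M by (simp add: power2_eq_square mult_le_cancel_left1)
  have "P (j0 + 2 * s) - 2 * P (j0 + s) + P j0 = 2 * (a * int s ^ 2)"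
    by (simp add: P_def power2_eq_square algebra_simps)
  then have "\<bar>a * int s ^ 2\<bar> \<le> 2 * M"
    using P[of "j0 + 2 * s"] P[of "j0 + s"] P[of j0] by (simp add: abs_le_iff)
  moreover have "int s ^ 2 \<le> \<bar>a * int s ^ 2\<bar>" if "a \<noteq> 0"
    using that mult_right_mono[of 1 "\<bar>a\<bar>" "int s ^ 2"] by (auto simp: abs_mult)
  ultimately have a: "a = 0" using s le by linarith
  have "P (j0 + s) - P j0 = b * int s" by (simp add: P_def a algebra_simps)
  then have "\<bar>b * int s\<bar> \<le> M" using P[of "j0 + s"] P[of j0] by (simp add: abs_le_iff)
  moreover have "int s \<le> \<bar>b * int s\<bar>" if "b \<noteq> 0"
    using that mult_right_mono[of 1 "\<bar>b\<bar>" "int s"] by (auto simp: abs_mult)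
  ultimately have "b = 0" using s M by linarith
  then show ?thesis using a by simp
qed

text \<open>From the first entry that is not 1, sortedness makes all entries at least 2, and the sum
  leaves room for only one of them.\<close>

lemma sorted_sum_list_eq_Suc_length:
  assumes "sorted xs" "\<forall>x\<in>set xs. 1 \<le> x" "sum_list xs = Suc (length xs)"
  shows "xs = replicate (length xs - 1) 1 @ [2::nat]"
  using assms
proof (induction xs)
  case (Cons x xs)
  show ?case
  proof (cases "x = 1")
    case True
    then have "xs \<noteq> []" using Cons.prems by auto
    then obtain k where "length xs = Suc k" by (cases xs) auto
    then show ?thesis using Cons True by simp
  next
    case False
    then have x2: "2 \<le> x" using Cons.prems(2) by auto
    then have "\<forall>y\<in>set xs. 2 \<le> y" using Cons.prems(1) by force
    then have "2 * length xs \<le> sum_list xs" by (induction xs) auto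
    then have "xs = []" using x2 Cons.prems(3) by (cases xs) auto
    then show ?thesis using Cons.prems by simp
  qed
qed simp

section \<open>Elements and graded pieces of the Jacobian ideal\<close>

lemma genpd_homog: "homog d f \<Longrightarrow> homog (d - 1) (genpd f t)"
proof -
  assume f: "homog d f"
  have "homog (d - 1) (const3 c * p)" if "homog (d - 1) p" for c p
    using that by (simp add: homog_iff lookup_const3_mult)
  then show ?thesis unfolding genpd_def using homog_pd[OF f] by (intro homog_add) auto
qed

lemma genpd_in_jac_ideal: "genpd f t \<in> jac_ideal f"
proof -
  have "genpd f t = 1 * pdx f + const3 (of_nat t) * pdy f + const3 (of_nat t ^ 2) * pdz f"
    by (simp add: genpd_def)
  then show ?thesis unfolding jac_ideal_def by blast
qed

lemma euler_in_jac_ideal: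
  assumes "homog d f" "d > 0"
  shows "f \<in> jac_ideal f"
proof -
  have "f = const3 (1 / of_nat d) * (const3 (of_nat d) * f)"
    using assms(2) by (simp add: const3_mult flip: mult.assoc)
  also have "\<dots> = const3 (1 / of_nat d) * varX * pdx f + const3 (1 / of_nat d) * varY * pdy f
      + const3 (1 / of_nat d) * varZ * pdz f"
    unfolding euler[OF assms(1), symmetric] by (simp add: algebra_simps)
  finally show ?thesis unfolding jac_ideal_def by blast
qed

lemma jac_ideal_comb:
  assumes "p \<in> jac_ideal f" "q \<in> jac_ideal f"
  shows "a * p + b * q \<in> jac_ideal f"
proof -
  obtain p1 p2 p3 q1 q2 q3 where "p = p1 * pdx f + p2 * pdy f + p3 * pdz f"
    "q = q1 * pdx f + q2 * pdy f + q3 * pdz f"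
    using assms by (auto simp: jac_ideal_def)
  then have "a * p + b * q = (a * p1 + b * q1) * pdx f + (a * p2 + b * q2) * pdy f + (a * p3 + b * q3) * pdz f"
    by (simp add: algebra_simps)
  then show ?thesis unfolding jac_ideal_def by blast
qed

text \<open>\<open>S.dim\<close> is the cardinality of a basis and an infinite basis counts as 0,
  hence the finite spanning set.\<close>

lemma dim_subset_finite_span:
  assumes "A \<subseteq> B" "B \<subseteq> S.span C" "finite C"
  shows "S.dim A \<le> S.dim B"
proof -
  obtain BA where BA: "BA \<subseteq> A" "S.independent BA" "A \<subseteq> S.span BA" "card BA = S.dim A"
    by (rule S.basis_exists)
  obtain BB where BB: "BB \<subseteq> B" "S.independent BB" "B \<subseteq> S.span BB" "card BB = S.dim B"
    by (rule S.basis_exists)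
  have "finite BB" using S.independent_span_bound[OF assms(3) BB(2)] BB(1) assms(2) by blast
  moreover have "BA \<subseteq> S.span BB" using BA(1) BB(3) assms(1) by blast
  ultimately show ?thesis using S.independent_span_bound[of BB BA] BA(2,4) BB(4) by simp
qed

lemma int_hdim: "2 * int (hdim k) = (int k + 1) * (int k + 2)"
proof -
  have "2 * int (hdim k) = int (2 * hdim k)" by simp
  also have "\<dots> = (int k + 1) * (int k + 2)" unfolding dim_homog by (simp add: algebra_simps)
  finally show ?thesis .
qed

lemma less_3: "i < 3 \<longleftrightarrow> i = 0 \<or> i = 1 \<or> i = (2::nat)"
  by auto

section \<open>The resolution attached to the curve\<close>

text \<open>Generation of \<open>D0 f\<close> by \<open>\<rho>s\<close> becomes exactness at S^3,
  and generation of \<open>syz \<rho>s\<close> by \<open>gs\<close> becomes exactness at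
  S^m.\<close>

lemma graded_resolution_D0:
  assumes "homog d f" "length \<rho>s = m" "minimal_gens_D0 f r \<rho>s"
    and gs: "length eps = length gs"
     "\<forall>i < length gs. length (gs ! i) = m \<and> hvec (eps ! i) (gs ! i)"
     "submod m gs = syz \<rho>s" "irredundant m gs"
  shows "graded_resolution (\<lambda>i. [pdx f, pdy f, pdz f] ! i) (\<lambda>j i. \<rho>s ! j ! i) (\<lambda>l j. gs ! l ! j)
    m (length gs) r (d - 1) (\<lambda>l. eps ! l)"
proof
  have min: "submod 3 \<rho>s = D0 f" "\<And>\<rho>. \<rho> \<in> set \<rho>s \<Longrightarrow> length \<rho> = 3 \<and> hvec r \<rho>"
    using assms(3) by (auto simp: minimal_gens_D0_def)
  show "(\<Sum>i<3. v i * [pdx f, pdy f, pdz f] ! i) = 0 \<longleftrightarrow>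
      (\<exists>h. \<forall>i<3. v i = (\<Sum>j<m. h j * \<rho>s ! j ! i))" for v
  proof -
    have "(\<Sum>i<3. v i * [pdx f, pdy f, pdz f] ! i) = 0 \<longleftrightarrow> [v 0, v 1, v 2] \<in> D0 f"
      by (simp add: D0_def eval_nat_numeral)
    also have "\<dots> \<longleftrightarrow> (\<exists>h. \<forall>i<3. [v 0, v 1, v 2] ! i = (\<Sum>j<m. h j * \<rho>s ! j ! i))"
      unfolding min(1)[symmetric] using assms(2) by (subst submod_iff) auto
    also have "\<dots> \<longleftrightarrow> (\<exists>h. \<forall>i<3. v i = (\<Sum>j<m. h j * \<rho>s ! j ! i))"
    proof -
      have "[v 0, v 1, v 2] ! i = v i" if "i < 3" for i using that by (auto simp: less_3)
      then show ?thesis by simp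
    qed
    finally show ?thesis .
  qed
  show "(\<forall>i<3. (\<Sum>j<m. h j * \<rho>s ! j ! i) = 0) \<longleftrightarrow> (\<exists>c. \<forall>j<m. h j = (\<Sum>l<length gs. c l * gs ! l ! j))" for h
  proof -
    have "(\<forall>i<3. (\<Sum>j<m. h j * \<rho>s ! j ! i) = 0) \<longleftrightarrow> map h [0..<m] \<in> syz \<rho>s"
      by (simp add: syz_def lincomb_def assms(2) list_eq_iff_nth_eq)
    also have "\<dots> \<longleftrightarrow> (\<exists>c. \<forall>j<m. map h [0..<m] ! j = (\<Sum>l<length gs. c l * gs ! l ! j))"
      unfolding gs(3)[symmetric] by (subst submod_iff) simp_all
    also have "\<dots> \<longleftrightarrow> (\<exists>c. \<forall>j<m. h j = (\<Sum>l<length gs. c l * gs ! l ! j))" by simp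
    finally show ?thesis .
  qed
  show "homog (d - 1) ([pdx f, pdy f, pdz f] ! i)" if "i < 3" for i
    using that homog_pd[OF assms(1)] by (auto simp: less_3)
  show "homog r (\<rho>s ! j ! i)" if "j < m" "i < 3" for j i
    using min(2)[of "\<rho>s ! j"] that assms(2) by (auto simp: hvec_def)
  show "homog (eps ! l) (gs ! l ! j)" if "l < length gs" "j < m" for l j
    using gs(2) that by (auto simp: hvec_def)
  show "\<not> (\<exists>c. \<forall>j<m. gs ! l ! j = (\<Sum>l'\<in>{..<length gs} - {l}. c l' * gs ! l' ! j))" if "l < length gs" for l
    using gs(4) gs(2) that unfolding irredundant_def by (auto simp: submod_remove_iff)
qed

lemma homog_0_const: "homog 0 p \<Longrightarrow> p = const3 (lk p (0,0,0))"
proof (rule poly_mapping_eqI)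
  fix x :: mono3 assume p: "homog 0 p"
  obtain a b c where x: "x = (a,b,c)" by (cases x)
  show "lk p x = lk (const3 (lk p (0,0,0))) x"
  proof (cases "x = (0,0,0)")
    case False
    then have "lk p x = 0" using p by (auto simp: homog_iff x mdeg_def)
    then show ?thesis using False by (simp add: const3_def lookup_single_not_eq)
  qed (simp add: const3_def)
qed

text \<open>A generator of degree 0 is a relation among \<open>\<rho>s\<close> with constant
  coefficients. They are not all 0, since the zero tuple is redundant, and a nonzero one contradicts
  minimality of \<open>\<rho>s\<close>.\<close>

lemma syzygy_degree_pos:
  assumes "length \<rho>s = m" "minimal_gens_D0 f r \<rho>s"
    and gs: "\<forall>i < length gs. length (gs ! i) = m \<and> hvec (eps ! i) (gs ! i)"
     "submod m gs = syz \<rho>s" "irredundant m gs"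
    and l: "l < length gs"
  shows "1 \<le> eps ! l"
proof (rule ccontr)
  assume "\<not> 1 \<le> eps ! l"
  then have "eps ! l = 0" by simp
  then have h0: "homog 0 (gs ! l ! j)" if "j < m" for j
    using gs(1) l that by (metis hvec_def nth_mem)
  define c where "c j = lk (gs ! l ! j) (0,0,0)" for j
  have c: "gs ! l ! j = const3 (c j)" if "j < m" for j
    using homog_0_const[OF h0[OF that]] by (simp add: c_def)
  have len: "length (gs ! l) = m" using gs(1) l by blast
  have "\<exists>j0<m. c j0 \<noteq> 0"
  proof (rule ccontr)
    assume "\<not> (\<exists>j0<m. c j0 \<noteq> 0)"
    then have "gs ! l ! j = 0" if "j < m" for j using c[OF that] that by (simp add: const3_def)
    then have "gs ! l \<in> submod m (take l gs @ drop (Suc l) gs)"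
      unfolding submod_remove_iff[OF len l] by (intro exI[of _ "\<lambda>_. 0"]) simp
    then show False using gs(3) l by (simp add: irredundant_def)
  qed
  then obtain j0 where j0: "j0 < m" "c j0 \<noteq> 0" by blast
  have "gs ! l \<in> submod m gs"
    unfolding submod_iff[OF len]
  proof (intro exI allI impI)
    fix i show "gs ! l ! i = (\<Sum>j<length gs. (if j = l then 1 else 0) * gs ! j ! i)"
      using l by (simp add: if_distrib[of "\<lambda>x. x * _"] cong: if_cong)
  qed
  then have "lincomb 3 (gs ! l) \<rho>s = replicate 3 0" unfolding gs(2) syz_def by simp
  then have "(\<Sum>j<m. const3 (c j) * \<rho>s ! j ! i) = 0" if "i < 3" for i
    using that c by (auto simp: lincomb_def list_eq_iff_nth_eq assms(1))
  then show False using minimal_gens_no_unit_relation[OF assms(2), of j0 c] j0 assms(1) by simp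
qed

theorem theorem3p2:
  fixes f :: poly3 and d r m :: nat and \<rho>s :: "poly3 list list"
    and gs :: "poly3 list list" and eps :: "nat list"
  assumes "d \<ge> 3"
    and "reduced3 f" and "homog d f"
    and "\<not> concurrent_lines d f"
    and "length \<rho>s = m" and "minimal_gens_D0 f r \<rho>s"
    and "m > 3"
    and "(2 * int r - int d + 3) - int m = 1"
    and "length eps = length gs"
    and "\<forall>i < length gs. length (gs ! i) = m \<and> hvec (eps ! i) (gs ! i)"
    and "submod m gs = syz \<rho>s" and "irredundant m gs"
    and "sorted eps"
  shows "eps = replicate (m - 3) 1 @ [2]
       \<and> int (tjurina f) = int d * (int d - 1) div 2 - 1 + int r * (int d - int r - 2)"
proof -
  \<comment> \<open>\<open>e\<close> is the degree of the partial derivatives. That \<open>n\<close>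
    equals \<open>m - 2\<close> comes out only later, from the growth of the Hilbert
    function.\<close>
  define e n where "e = d - 1" and "n = length gs"
  interpret graded_resolution "\<lambda>i. [pdx f, pdy f, pdz f] ! i" "\<lambda>j i. \<rho>s ! j ! i" "\<lambda>l j. gs ! l ! j"
    m n r e "\<lambda>l. eps ! l"
    unfolding n_def e_def by (rule graded_resolution_D0) fact+
  obtain t where reg: "\<And>w. f dvd w * genpd f t \<Longrightarrow> f dvd w" using ex_genpd_regular[OF assms(2)] by blast
  have f0: "f \<noteq> 0" using assms(2) by (simp add: reduced3_def)
  have "p \<in> jac_ideal f \<longleftrightarrow> (\<exists>v. p = (\<Sum>i<3. v i * [pdx f, pdy f, pdz f] ! i))" for p
  proof
    assume "p \<in> jac_ideal f"
    then obtain a b c where "p = a * pdx f + b * pdy f + c * pdz f" by (auto simp: jac_ideal_def)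
    then have "p = (\<Sum>i<3. [a,b,c] ! i * [pdx f, pdy f, pdz f] ! i)"
      by (simp add: eval_nat_numeral)
    then show "\<exists>v. p = (\<Sum>i<3. v i * [pdx f, pdy f, pdz f] ! i)"
      by (rule exI[of _ "\<lambda>i. [a,b,c] ! i"])
  next
    assume "\<exists>v. p = (\<Sum>i<3. v i * [pdx f, pdy f, pdz f] ! i)"
    then obtain v where "p = (\<Sum>i<3. v i * [pdx f, pdy f, pdz f] ! i)" by blast
    then have "p = v 0 * pdx f + v 1 * pdy f + v 2 * pdz f"
      by (simp add: eval_nat_numeral)
    then show "p \<in> jac_ideal f" unfolding jac_ideal_def by blast
  qed
  then have J: "jac_piece k = {p \<in> jac_ideal f. homog k p}" for k by (auto simp: jac_piece_def)
  have hilb: "hilb_M f k = hdim k - S.dim (jac_piece k)" for k by (simp add: hilb_M_def J)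
  have upper: "S.dim (jac_piece k) \<le> hdim k" for k
    by (rule dim_subset_finite_span[OF _ homog_subset_span finite_monomials]) (auto simp: J)
  \<comment> \<open>\<open>f\<close> and \<open>genpd f t\<close> generate a smaller ideal, whose
    quotient has dimension d e in every degree from d + e on.\<close>
  have lower: "int (hdim k) - int (S.dim (jac_piece k)) \<le> int d * int e" if k: "k \<ge> d + e" for k
  proof -
    have ineq: "2 * (int h - int y) \<le> 2 * int h - 2 * int p - 2 * int q + 2 * int w"
      if "x \<le> y" "x + w = p + q" for x y w p q h :: nat using that by presburger
    let ?I = "{a * f + b * genpd f t | a b. homog (k - d) a \<and> homog (k - e) b}"
    have "homog k (a * f)" "homog k (b * genpd f t)" if "homog (k - d) a" "homog (k - e) b" for a b
      using homog_mult[OF that(1) assms(3)] homog_mult[OF that(2) genpd_homog[OF assms(3)]] k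
      by (simp_all add: e_def)
    then have "?I \<subseteq> jac_piece k"
      using jac_ideal_comb[OF euler_in_jac_ideal[OF assms(3)] genpd_in_jac_ideal[of f t]] assms(1)
      by (auto simp: J intro: homog_add)
    moreover have "jac_piece k \<subseteq> S.span (monomials k)" using homog_subset_span by (auto simp: J)
    ultimately have "S.dim ?I \<le> S.dim (jac_piece k)" using dim_subset_finite_span finite_monomials by blast
    moreover have "S.dim ?I + hdim (k - d - e) = hdim (k - d) + hdim (k - e)"
      using dim_ideal_regular_pair[OF assms(3) f0 genpd_homog[OF assms(3), folded e_def] reg k] by blast
    ultimately have "2 * (int (hdim k) - int (S.dim (jac_piece k)))
        \<le> 2 * int (hdim k) - 2 * int (hdim (k - d)) - 2 * int (hdim (k - e)) + 2 * int (hdim (k - d - e))"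
      by (rule ineq)
    also have "\<dots> = 2 * (int d * int e)"
      unfolding int_hdim using k by (simp add: of_nat_diff algebra_simps)
    finally show ?thesis by simp
  qed
  \<comment> \<open>Coefficients of twice the Hilbert polynomial as a polynomial in
    \<open>j\<close>, where the degree is \<open>j + r + e\<close>; \<open>a\<close> is the
    alternating sum of the ranks in the resolution.\<close>
  define a b c where "a = 1 - 3 + int m - int n"
    and "b = 2 * (int r + int e) + 3 - 3 * (2 * int r + 3) + 3 * int m - 3 * int n + 2 * (\<Sum>l<n. int (eps ! l))"
    and "c = (int r + int e + 1) * (int r + int e + 2) - 3 * (int r + 1) * (int r + 2) + 2 * int m
      - (\<Sum>l<n. (1 - int (eps ! l)) * (2 - int (eps ! l)))"
  \<comment> \<open>Large enough for \<open>eps ! l\<close> to be at most \<open>j\<close>, and for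
    \<open>lower\<close> to apply in degree \<open>j + r + e\<close>.\<close>
  define j0 where "j0 = sum_list eps + d"
  have formula: "2 * (int (hdim (j + r + e)) - int (S.dim (jac_piece (j + r + e)))) = a * int j ^ 2 + b * int j + c"
    if j: "j \<ge> j0" for j
  proof -
    have le: "eps ! l \<le> j" if "l < n" for l
      using j member_le_sum_list[of "eps ! l" eps] that assms(9) by (simp add: j0_def n_def)
    have dJ: "int (S.dim (jac_piece (j + r + e))) = 3 * int (hdim (j + r)) - int (m * hdim j) + int (\<Sum>l<n. hdim (j - eps ! l))"
    proof -
      have x: "V.dim (syz_piece j) = (\<Sum>l<n. hdim (j - eps ! l))" by (rule dim_syz_piece) (rule le)
      have ar: "int z = 3 * int q - int w + int x" if "x + y = w" "y + z = 3 * q" for x y z w q :: nat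
        using that by presburger
      show ?thesis by (rule ar[OF dim_D0_piece[of j, unfolded x] dim_jac_piece[of "j + r"]])
    qed
    have "2 * (int (hdim (j + r + e)) - int (S.dim (jac_piece (j + r + e)))) =
      2 * int (hdim (j + r + e)) - 3 * (2 * int (hdim (j + r))) + int m * (2 * int (hdim j))
        - (\<Sum>l<n. 2 * int (hdim (j - eps ! l)))"
      unfolding dJ by (simp add: algebra_simps sum_distrib_left)
    \<comment> \<open>Expands each doubled dimension in powers of \<open>j\<close>; the part free of
      \<open>j\<close> is the value of (k + 1)(k + 2) at k = - eps.\<close>
    also have "(\<Sum>l<n. 2 * int (hdim (j - eps ! l)))
      = (\<Sum>l<n. (int j ^ 2 + 3 * int j) - 2 * int j * int (eps ! l) + (1 - int (eps ! l)) * (2 - int (eps ! l)))"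
      by (rule sum.cong[OF refl], subst int_hdim)
        (use le in \<open>simp add: of_nat_diff power2_eq_square algebra_simps\<close>)
    also have "\<dots> = int n * (int j ^ 2 + 3 * int j) - 2 * int j * (\<Sum>l<n. int (eps ! l))
        + (\<Sum>l<n. (1 - int (eps ! l)) * (2 - int (eps ! l)))"
      by (simp add: sum.distrib sum_subtractf sum_distrib_left)
    finally show ?thesis
      unfolding int_hdim a_def b_def c_def by (simp add: power2_eq_square algebra_simps)
  qed
  have "a = 0 \<and> b = 0"
  proof (rule bounded_quadratic_int)
    fix j assume j: "j \<ge> j0"
    show "0 \<le> a * int j ^ 2 + b * int j + c \<and> a * int j ^ 2 + b * int j + c \<le> 2 * (int d * int e)"
      unfolding formula[OF j, symmetric]
      using upper[of "j + r + e"] lower[of "j + r + e"] j by (simp add: j0_def)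
  qed
  then have a0: "a = 0" and b0: "b = 0" by auto
  have e: "int e = int d - 1" using assms(1) by (simp add: e_def)
  have n: "int n = int m - 2" using a0 by (simp add: a_def)
  \<comment> \<open>With \<open>n = m - 2\<close>, vanishing of \<open>b\<close> says that the
    degrees add up to 2 r - e = 2 r - d + 1, which is m - 1 by the assumption on the defect.\<close>
  have sum_eps: "(\<Sum>l<n. int (eps ! l)) = int n + 1"
    using b0 n e assms(8) by (simp add: b_def)
  have "int (sum_list eps) = (\<Sum>l<n. int (eps ! l))"
    by (simp add: sum_list_sum_nth atLeast0LessThan assms(9) n_def)
  then have "sum_list eps = Suc (length eps)" using sum_eps assms(9) by (simp add: n_def)
  moreover have "\<forall>x\<in>set eps. 1 \<le> x"
  proof
    fix x assume "x \<in> set eps"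
    then obtain l where "l < length gs" "x = eps ! l" using assms(9) by (metis in_set_conv_nth)
    then show "1 \<le> x" using syzygy_degree_pos[OF assms(5,6,10,11,12)] by simp
  qed
  ultimately have "eps = replicate (length eps - 1) 1 @ [2]"
    using sorted_sum_list_eq_Suc_length assms(13) by blast
  moreover have "length eps - 1 = m - 3" using n assms(7,9) by (simp add: n_def)
  ultimately have eps: "eps = replicate (m - 3) 1 @ [2]" by simp
  \<comment> \<open>The degrees 1 and 2 are exactly the roots of this product, so the constant
    coefficient depends only on \<open>d\<close>, \<open>r\<close> and \<open>m\<close>.\<close>
  have "(1 - int (eps ! l)) * (2 - int (eps ! l)) = 0" if "l < n" for l
  proof -
    have "l < Suc (m - 3)" using that n assms(7) by linarith
    then have "eps ! l = 1 \<or> eps ! l = 2" unfolding eps by (auto simp: nth_append)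
    then show ?thesis by auto
  qed
  then have "(\<Sum>l<n. (1 - int (eps ! l)) * (2 - int (eps ! l))) = 0" by (intro sum.neutral) blast
  then have "c = (int r + int e + 1) * (int r + int e + 2) - 3 * (int r + 1) * (int r + 2) + 2 * int m"
    by (simp add: c_def)
  moreover have "int m = 2 * int r - int d + 2" using assms(8) by simp
  ultimately have c: "c = int d * (int d - 1) + 2 * (int r * (int d - int r - 2) - 1)"
    unfolding e by (simp add: algebra_simps)
  \<comment> \<open>Both summands of \<open>c\<close> are even, so the division by 2 can be carried
    out term by term.\<close>
  have "even (int d * (int d - 1))" by simp
  then have c2: "c div 2 = int d * (int d - 1) div 2 - 1 + int r * (int d - int r - 2)"
    unfolding c by (simp add: div_plus_div_distrib_dvd_left)
  have "hilb_M f k = nat (c div 2)" if k: "k \<ge> j0 + r + e" for k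
  proof -
    define j where "j = k - r - e"
    have j: "j \<ge> j0" "k = j + r + e" using k by (simp_all add: j_def)
    have "2 * (int (hdim k) - int (S.dim (jac_piece k))) = c" using formula[OF j(1)] a0 b0 j(2) by simp
    then have "int (hilb_M f k) = c div 2" unfolding hilb of_nat_diff[OF upper] by simp
    then show ?thesis by simp
  qed
  then have ev: "\<forall>\<^sub>F k in sequentially. hilb_M f k = nat (c div 2)"
    unfolding eventually_sequentially by blast
  have "tjurina f = nat (c div 2)"
    unfolding tjurina_def
  proof (rule the_equality)
    show "\<forall>\<^sub>F k in sequentially. hilb_M f k = nat (c div 2)" by (rule ev)
  next
    fix t' assume "\<forall>\<^sub>F k in sequentially. hilb_M f k = t'"
    \<comment> \<open>Two eventual values agree at some common degree.\<close>
    with ev have "\<forall>\<^sub>F k in sequentially. t' = nat (c div 2)" by eventually_elim simp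
    then show "t' = nat (c div 2)" by simp
  qed
  \<comment> \<open>Ensures that \<open>nat\<close> does not truncate when passing back to
    integers.\<close>
  moreover have "c \<ge> 0" using formula[of j0] upper[of "j0 + r + e"] a0 b0 by simp
  ultimately show ?thesis using eps c2 by simp
qed

end
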